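(* Let $\{X_{n,j}: 1\le j\le n,\ n\in\mathbb{N}\}$ be a triangular array of independent non-negative random variables, and suppose that the distribution $\mathcal{P}_{n,j}$ of $X_{n,j}$ is non-atomic for all $n,j$. Let $\{c_{n,j}: 1\le j\le n,\ n\in\mathbb{N}\}$ be a triangular array of positive constants and put $d_n=\sum_{j=1}^n c_{n,j}$. Suppose the following. (1) As $n\to\infty$, $d_n\to\infty$ and $\frac{\max_{j\le n} c_{n,j}}{d_n}\to 0$, and the measures $\mu_n=\sum_{j=1}^n \frac{c_{n,j}}{d_n}\delta_{\{j/n\}}$ on $[0,1]$ converge weakly to a measure $\mu$. (2) There is a non-atomic measure $\gamma$ on $\mathbb{R}_+=(0,\infty]$ such that for every $j$, $\frac{d_n}{c_{n,j}}\mathcal{P}_{n,j}\to\gamma$ vaguely on $\mathbb{R}_+$ as $n\to\infty$, and this convergence is uniform in the sense that, for every $t>0$, $$\Delta_n(t):=\sup_{f\in \mathbb{C}^+_{K,t}}\ \max_{j\le n}\left|\frac{d_n}{c_{n,j}}\int f\,d\mathcal{P}_{n,j}-\int f\,d\gamma\right|\to 0\quad (n\to\infty).$$ Define the point processes $\zeta_n=\sum_{j=1}^n\delta_{\{(j/n,\,X_{n,j})\}}$ on $[0,1]\times\mathbb{R}_+$. Then, as $n\to\infty$, $$\zeta_n\Longrightarrow\zeta,$$ where $\zeta$ is a Poisson point process on $[0,1]\times\mathbb{R}_+$ with intensity measure $\mu\times\gamma$.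
   Context: $\mathbb{R}_+=(0,\infty]$ is the half-line with the point $+\infty$ added, with metric $\rho(x,y)=|1/x-1/y|$ (where $1/\infty=0$); a subset is compact iff it is closed and separated from $0$. $\delta_{\{a\}}$ is the unit mass at $a$. $\mathbb{C}^+_{K,t}$ is the set of non-negative $\rho$-continuous functions on $\mathbb{R}_+$ with compact support contained in $[t,\infty]$, and $\mathbb{C}_K^+=\bigcup_{t>0}\mathbb{C}^+_{K,t}$. Measures $\tau_n$ on $\mathbb{R}_+$ converge vaguely to $\tau$ if $\int f\,d\tau_n\to\int f\,d\tau$ for every $f\in\mathbb{C}_K^+$; vague convergence on $[0,1]\times\mathbb{R}_+$ is defined analogously with non-negative continuous compactly supported functions. All measures considered on $\mathbb{R}_+$ are finite on $[t,\infty]$ for every $t>0$ and have no atom at $+\infty$; the $\mathcal{P}_{n,j}$ are regarded as measures on $\mathbb{R}_+$ (being non-atomic, they give no mass to $0$). Point processes on $[0,1]\times\mathbb{R}_+$ are random elements of the space of locally finite point measures (finite on $[0,1]\times[t,\infty]$ for every $t>0$) with the vague topology, and $\Longrightarrow$ denotes convergence in distribution in this space. *)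

theory Defs
  imports "HOL-Probability.Probability"
begin

lemma isometry_countable_subbasis:
  fixes g :: "'a::metric_space \<Rightarrow> real"
  assumes iso: "\<And>x y. dist (g x) (g y) = dist x y"
  shows "\<exists>B::'a set set. countable B \<and> open = generate_topology B"
proof -
  obtain B :: "real set set" where B: "countable B" "topological_basis B"
    using ex_countable_basis by blast
  have cont: "continuous_on UNIV g"
    unfolding continuous_on_iff iso by auto
  have "topological_basis ((\<lambda>U. g -` U) ` B)"
  proof (rule topological_basisI)
    fix U assume "U \<in> (\<lambda>U. g -` U) ` B"
    then show "open U"
      using topological_basis_open[OF B(2)] cont by (auto intro!: open_vimage)
  next
    fix U :: "'a set" and x assume "open U" "x \<in> U"
    then obtain e where e: "0 < e" "\<And>y. dist y x < e \<Longrightarrow> y \<in> U"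
      unfolding open_dist by blast
    obtain V where V: "V \<in> B" "g x \<in> V" "V \<subseteq> ball (g x) e"
      using topological_basisE[OF B(2) open_ball, of "g x" "g x" e] e(1) by auto
    have "g -` V \<subseteq> U"
      using V(3) e(2) iso by (auto simp: subset_iff dist_commute)
    then show "\<exists>U'\<in>(\<lambda>U. g -` U) ` B. x \<in> U' \<and> U' \<subseteq> U"
      using V by blast
  qed
  then show ?thesis
    using B(1) topological_basis_imp_subbasis by blast
qed

typedef rplus = "{x::ereal. 0 < x}"
  by (rule exI[of _ \<infinity>]) simp

definition rplus_of_real :: "real \<Rightarrow> rplus" where
  "rplus_of_real x = Abs_rplus (ereal x)"

definition recip :: "rplus \<Rightarrow> real" where
  "recip x = real_of_ereal (1 / Rep_rplus x)"

lemma recip_cases: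
  obtains "x = Abs_rplus \<infinity>" "Rep_rplus x = \<infinity>" "recip x = 0"
  | r where "0 < r" "x = rplus_of_real r" "Rep_rplus x = ereal r" "recip x = 1 / r"
proof (cases "Rep_rplus x")
  case (real r)
  moreover have "0 < r"
    using Rep_rplus[of x] real by simp
  moreover have "x = rplus_of_real r"
    using real Rep_rplus_inverse[of x] by (simp add: rplus_of_real_def)
  ultimately show ?thesis
    using that(2)[of r] by (simp add: recip_def one_ereal_def)
next
  case PInf
  then show ?thesis
    using that(1) Rep_rplus_inverse[of x] by (simp add: recip_def)
next
  case MInf
  then show ?thesis
    using Rep_rplus[of x] by simp
qed

lemma recip_inj: "recip x = recip y \<longleftrightarrow> x = y"
proof
  assume eq: "recip x = recip y"
  show "x = y"
  proof (cases x rule: recip_cases)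
    case x: 1
    show ?thesis
    proof (cases y rule: recip_cases)
      case y: 1
      show ?thesis unfolding x(1) y(1) ..
    next
      case y: (2 s)
      show ?thesis using eq y(1) unfolding x(3) y(4) by simp
    qed
  next
    case x: (2 r)
    show ?thesis
    proof (cases y rule: recip_cases)
      case y: 1
      show ?thesis using eq x(1) unfolding x(4) y(3) by simp
    next
      case y: (2 s)
      have "r = s" using eq unfolding x(4) y(4) by simp
      then show ?thesis unfolding x(2) y(2) by simp
    qed
  qed
qed simp

lemma recip_le_iff:
  assumes "0 < t"
  shows "recip x \<le> 1 / t \<longleftrightarrow> ereal t \<le> Rep_rplus x"
proof (cases x rule: recip_cases)
  case (2 r)
  with assms show ?thesis
    unfolding 2(3,4) ereal_less_eq(3) by (simp add: divide_le_eq le_divide_eq mult.commute)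
next
  case 1
  show ?thesis
    unfolding 1(2,3) using assms by simp
qed

instantiation rplus :: metric_space
begin

definition dist_rplus :: "rplus \<Rightarrow> rplus \<Rightarrow> real" where
  "dist_rplus x y = \<bar>recip x - recip y\<bar>"

definition uniformity_rplus :: "(rplus \<times> rplus) filter" where
  "uniformity_rplus = (INF e\<in>{0<..}. principal {(x, y). dist x y < e})"

definition open_rplus :: "rplus set \<Rightarrow> bool" where
  "open_rplus U \<longleftrightarrow> (\<forall>x\<in>U. \<forall>\<^sub>F (x', y) in uniformity. x' = x \<longrightarrow> y \<in> U)"

instance
proof
  show "uniformity = (INF e\<in>{0<..}. principal {(x :: rplus, y). dist x y < e})"
    by (rule uniformity_rplus_def)
  show "open U \<longleftrightarrow> (\<forall>x\<in>U. \<forall>\<^sub>F (x', y) in uniformity. x' = x \<longrightarrow> y \<in> U)" for U :: "rplus set"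
    by (rule open_rplus_def)
  show "dist x y = 0 \<longleftrightarrow> x = y" for x y :: rplus
    by (simp add: dist_rplus_def recip_inj)
  show "dist x y \<le> dist x z + dist y z" for x y z :: rplus
    unfolding dist_rplus_def by linarith
qed

end

lemma dist_recip: "dist (recip x) (recip y) = dist x y"
  by (simp add: dist_rplus_def dist_real_def)

instance rplus :: second_countable_topology
  by standard (rule isometry_countable_subbasis[OF dist_recip])

lemma continuous_on_recip: "continuous_on A recip"
  unfolding continuous_on_iff dist_recip by auto

definition ray :: "real \<Rightarrow> rplus set" where
  "ray t = {x. ereal t \<le> Rep_rplus x}"

lemma compact_rplus_subset_ray:
  assumes "compact K"
  obtains t where "0 < t" "K \<subseteq> ray t"
proof -
  have "bounded (recip ` K)"
    using assms compact_continuous_image[OF continuous_on_recip] compact_imp_bounded by blast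
  then obtain b where b: "0 < b" "\<And>x. x \<in> K \<Longrightarrow> \<bar>recip x\<bar> \<le> b"
    unfolding bounded_pos by auto
  have "ereal (1 / b) \<le> Rep_rplus x" if "x \<in> K" for x
    using b(1) abs_le_D1[OF b(2)[OF that]] recip_le_iff[of "1 / b" x] by simp
  then show ?thesis
    using that[of "1 / b"] b(1) by (auto simp: ray_def)
qed

lemma measurable_rplus_of_real:
  "rplus_of_real \<in> borel_measurable (restrict_space borel {0<..})"
proof (rule borel_measurable_continuous_on_restrict)
  have "recip (rplus_of_real x) = 1 / x" if "0 < x" for x
    using that by (simp add: recip_def rplus_of_real_def Abs_rplus_inverse one_ereal_def)
  then have "dist (rplus_of_real x) (rplus_of_real y) = dist (1 / x) (1 / y)"
    if "0 < x" "0 < y" for x y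
    using that by (simp flip: dist_recip)
  moreover have "continuous_on {0<..} (\<lambda>x::real. 1 / x)"
    by (intro continuous_intros) auto
  ultimately show "continuous_on {0<..} rplus_of_real"
    unfolding continuous_on_iff by fastforce
qed

typedef unit_ivl = "{0..1::real}"
  by (rule exI[of _ 0]) simp

definition unit_of_real :: "real \<Rightarrow> unit_ivl" where
  "unit_of_real x = Abs_unit_ivl x"

instantiation unit_ivl :: metric_space
begin

definition dist_unit_ivl :: "unit_ivl \<Rightarrow> unit_ivl \<Rightarrow> real" where
  "dist_unit_ivl x y = \<bar>Rep_unit_ivl x - Rep_unit_ivl y\<bar>"

definition uniformity_unit_ivl :: "(unit_ivl \<times> unit_ivl) filter" where
  "uniformity_unit_ivl = (INF e\<in>{0<..}. principal {(x, y). dist x y < e})"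

definition open_unit_ivl :: "unit_ivl set \<Rightarrow> bool" where
  "open_unit_ivl U \<longleftrightarrow> (\<forall>x\<in>U. \<forall>\<^sub>F (x', y) in uniformity. x' = x \<longrightarrow> y \<in> U)"

instance
proof
  show "uniformity = (INF e\<in>{0<..}. principal {(x :: unit_ivl, y). dist x y < e})"
    by (rule uniformity_unit_ivl_def)
  show "open U \<longleftrightarrow> (\<forall>x\<in>U. \<forall>\<^sub>F (x', y) in uniformity. x' = x \<longrightarrow> y \<in> U)" for U :: "unit_ivl set"
    by (rule open_unit_ivl_def)
  show "dist x y = 0 \<longleftrightarrow> x = y" for x y :: unit_ivl
    by (simp add: dist_unit_ivl_def Rep_unit_ivl_inject)
  show "dist x y \<le> dist x z + dist y z" for x y z :: unit_ivl
    unfolding dist_unit_ivl_def by linarith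
qed

end

lemma dist_Rep_unit_ivl: "dist (Rep_unit_ivl x) (Rep_unit_ivl y) = dist x y"
  by (simp add: dist_unit_ivl_def dist_real_def)

instance unit_ivl :: second_countable_topology
  by standard (rule isometry_countable_subbasis[OF dist_Rep_unit_ivl])


definition CK_plus :: "('a::topological_space \<Rightarrow> real) set" where
  "CK_plus = {f. continuous_on UNIV f \<and> (\<forall>x. 0 \<le> f x) \<and> compact (closure {x. f x \<noteq> 0})}"

definition CK_plus_from :: "real \<Rightarrow> (rplus \<Rightarrow> real) set" where
  "CK_plus_from t = {f \<in> CK_plus. closure {x. f x \<noteq> 0} \<subseteq> ray t}"

lemma CK_plus_rplus: "CK_plus = (\<Union>t\<in>{0<..}. CK_plus_from t)"
proof -
  have "\<exists>t>0. f \<in> CK_plus_from t" if "f \<in> CK_plus" for f :: "rplus \<Rightarrow> real"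
  proof -
    have "compact (closure {x. f x \<noteq> 0})"
      using that by (simp add: CK_plus_def)
    then obtain t where "0 < t" "closure {x. f x \<noteq> 0} \<subseteq> ray t"
      by (rule compact_rplus_subset_ray)
    then show ?thesis
      using that by (auto simp: CK_plus_from_def)
  qed
  then show ?thesis
    by (auto simp: CK_plus_from_def)
qed

definition vague_conv :: "(nat \<Rightarrow> 'a::topological_space measure) \<Rightarrow> 'a measure \<Rightarrow> bool" where
  "vague_conv \<tau>s \<tau> \<longleftrightarrow>
     (\<forall>f\<in>CK_plus. (\<lambda>n. \<integral>x. f x \<partial>\<tau>s n) \<longlonglongrightarrow> (\<integral>x. f x \<partial>\<tau>))"

definition weak_conv_meas :: "(nat \<Rightarrow> 'a::topological_space measure) \<Rightarrow> 'a measure \<Rightarrow> bool" where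
  "weak_conv_meas \<tau>s \<tau> \<longleftrightarrow>
     (\<forall>f::'a \<Rightarrow> real. continuous_on UNIV f \<longrightarrow> bounded (range f) \<longrightarrow>
        (\<lambda>n. \<integral>x. f x \<partial>\<tau>s n) \<longlonglongrightarrow> (\<integral>x. f x \<partial>\<tau>))"

text \<open>Absence of point masses; the measures concerned are Borel measures on separable metric spaces.\<close>

definition non_atomic :: "'a measure \<Rightarrow> bool" where
  "non_atomic \<tau> \<longleftrightarrow> (\<forall>x. emeasure \<tau> {x} = 0)"

definition on_rplus :: "real measure \<Rightarrow> rplus measure" where
  "on_rplus P = distr (restrict_space P {0<..}) borel rplus_of_real"


text \<open>
  The image of counting measure on an index set \<open>I\<close> under \<open>x\<close> is the sum over \<open>i \<in> I\<close> of the
  unit masses at \<open>x i\<close>, with multiplicities.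
\<close>

definition dirac_sum :: "'i set \<Rightarrow> ('i \<Rightarrow> 'a::topological_space) \<Rightarrow> 'a measure" where
  "dirac_sum I x = distr (count_space I) borel x"

definition point_measures :: "(unit_ivl \<times> rplus) measure set" where
  "point_measures =
     {m. (\<exists>(I::nat set) x. m = dirac_sum I x) \<and> (\<forall>t>0. emeasure m (UNIV \<times> ray t) < \<infinity>)}"

definition vague_topology :: "(unit_ivl \<times> rplus) measure topology" where
  "vague_topology = topology_generated_by
     {{m \<in> point_measures. (\<integral>z. f z \<partial>m) \<in> U} | f U. f \<in> CK_plus \<and> open U}"

definition borel_of :: "'a topology \<Rightarrow> 'a measure" where
  "borel_of T = sigma (topspace T) {U. openin T U}"

definition conv_in_distr ::
  "'x topology \<Rightarrow> 'a measure \<Rightarrow> (nat \<Rightarrow> 'a \<Rightarrow> 'x) \<Rightarrow> 'b measure \<Rightarrow> ('b \<Rightarrow> 'x) \<Rightarrow> bool" where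
  "conv_in_distr T M Zs N Z \<longleftrightarrow>
     (\<forall>n. Zs n \<in> M \<rightarrow>\<^sub>M borel_of T) \<and> Z \<in> N \<rightarrow>\<^sub>M borel_of T \<and>
     (\<forall>F. continuous_map T euclideanreal F \<longrightarrow> bounded (F ` topspace T) \<longrightarrow>
        (\<lambda>n. \<integral>\<omega>. F (Zs n \<omega>) \<partial>M) \<longlonglongrightarrow> (\<integral>\<omega>. F (Z \<omega>) \<partial>N))"

definition poisson_process ::
  "'b measure \<Rightarrow> ('b \<Rightarrow> (unit_ivl \<times> rplus) measure) \<Rightarrow> (unit_ivl \<times> rplus) measure \<Rightarrow> bool" where
  "poisson_process N Z \<Lambda> \<longleftrightarrow>
     Z \<in> N \<rightarrow>\<^sub>M borel_of vague_topology \<and>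
     (\<forall>B\<in>sets borel. emeasure \<Lambda> B < \<infinity> \<longrightarrow>
        (\<forall>k::nat. measure N {\<omega> \<in> space N. emeasure (Z \<omega>) B = of_nat k} =
           exp (- measure \<Lambda> B) * measure \<Lambda> B ^ k / fact k)) \<and>
     (\<forall>(I::nat set) B. finite I \<longrightarrow> (\<forall>i\<in>I. B i \<in> sets borel) \<longrightarrow> disjoint_family_on B I \<longrightarrow>
        prob_space.indep_vars N (\<lambda>_. borel) (\<lambda>i \<omega>. emeasure (Z \<omega>) (B i)) I)"


definition row_sum :: "(nat \<Rightarrow> nat \<Rightarrow> real) \<Rightarrow> nat \<Rightarrow> real" where
  "row_sum c n = (\<Sum>j=1..n. c n j)"

definition weight_measure :: "(nat \<Rightarrow> nat \<Rightarrow> real) \<Rightarrow> nat \<Rightarrow> unit_ivl measure" where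
  "weight_measure c n =
     distr (point_measure {1..n} (\<lambda>j. ennreal (c n j / row_sum c n))) borel
       (\<lambda>j. unit_of_real (real j / real n))"

text \<open>
  Extended-valued, since the test functions are not normalised and the supremum may be infinite.
\<close>

definition discrepancy ::
  "(nat \<Rightarrow> nat \<Rightarrow> real) \<Rightarrow> (nat \<Rightarrow> nat \<Rightarrow> rplus measure) \<Rightarrow> rplus measure \<Rightarrow> nat \<Rightarrow> real \<Rightarrow> ennreal" where
  "discrepancy c P \<gamma> n t =
     (SUP f\<in>CK_plus_from t. MAX j\<in>{1..n}.
        ennreal \<bar>row_sum c n / c n j * (\<integral>x. f x \<partial>P n j) - (\<integral>x. f x \<partial>\<gamma>)\<bar>)"

text \<open>
  Indices with \<open>X n j \<omega> = 0\<close> are dropped, because \<open>(j/n, 0)\<close> is not a point of the space.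
\<close>

definition row_process ::
  "(nat \<Rightarrow> nat \<Rightarrow> 'a \<Rightarrow> real) \<Rightarrow> nat \<Rightarrow> 'a \<Rightarrow> (unit_ivl \<times> rplus) measure" where
  "row_process X n \<omega> =
     dirac_sum {j \<in> {1..n}. 0 < X n j \<omega>}
       (\<lambda>j. (unit_of_real (real j / real n), rplus_of_real (X n j \<omega>)))"

end

theory Submission
  imports Defs
begin

text \<open>
  Convergence in distribution is tested on bounded vaguely continuous functionals \<open>F\<close>. The plan is to
  squeeze \<open>F\<close> between functions of finitely many cell counts, for which only elementary Poisson
  limits are needed.

  At level \<open>m\<close> the region of points \<open>(x, y)\<close> with \<open>recip y < m\<close> is cut into finitely many half-open
  cells, any two points of which are less than \<open>2 / m\<close> apart. If for every \<open>m\<close> a point measure \<open>\<eta> m\<close> has the same cell counts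
  at level \<open>m\<close> as a point measure \<open>\<xi>\<close>, then \<open>\<eta>\<close> converges vaguely to \<open>\<xi>\<close>, because test functions are
  uniformly continuous (\<open>integral_tendsto_of_same_counts\<close>). Let \<open>U m\<close> be the supremum of \<open>F\<close> over all
  point measures with prescribed counts at level \<open>m\<close>. Then \<open>F \<xi> \<le> U m (counts \<xi>)\<close>, and the right side
  converges to \<open>F \<xi>\<close> as \<open>m\<close> grows. If the count vectors of the row processes converge in law to those
  of \<open>\<zeta>\<close> for each fixed \<open>m\<close>, then the upper limit of the expectations of \<open>F\<close> is at most the expectation
  of \<open>U m\<close> on the counts of \<open>\<zeta>\<close>, and dominated convergence in \<open>m\<close> brings this down to the
  expectation of \<open>F \<zeta>\<close>. Applying the same bound to \<open>- F\<close> gives \<open>conv_in_distr_of_counts\<close>.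

  Convergence of count vectors follows from that of their generating functions. For a row of
  independent points the generating function is a product of factors \<open>1 - q n j\<close>, since each point
  lies in at most one cell; for the Poisson process it is \<open>exp (- L)\<close>. The product converges to
  \<open>exp (- L)\<close> as soon as the \<open>q n j\<close> are uniformly small and their row sums tend to \<open>L\<close>.
  These row sums are weighted sums of \<open>P n j\<close>-masses of cells, and they converge because \<open>P n j\<close>
  is uniformly close to \<open>c n j / row_sum c n\<close> times \<open>\<gamma>\<close> on cells, while the weights falling into a
  subinterval of \<open>[0, 1]\<close> converge to its \<open>\<mu>\<close>-mass. Both facts need cell boundaries of measure zero.
  For \<open>\<gamma>\<close>, which has no atoms, this is automatic; as \<open>\<mu>\<close> may have atoms, the grid on \<open>[0, 1]\<close> is shifted by an
  offset \<open>\<theta>\<close> that avoids the countably many bad positions.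
\<close>

section \<open>Test functions and point measures\<close>

text \<open>
  The cover of the support by the open sets on which \<open>f\<close> varies by less than \<open>e\<close> has a Lebesgue number.
  Beyond the support nothing has to be checked: if both points lie outside it, \<open>f\<close> vanishes at both.
\<close>

lemma compact_support_uniformly_continuous:
  fixes f :: "'a::metric_space \<Rightarrow> real"
  assumes cont: "continuous_on UNIV f" and supp: "compact (closure {x. f x \<noteq> 0})" and "0 < e"
  obtains d where "0 < d" "\<And>x y. dist x y < d \<Longrightarrow> \<bar>f x - f y\<bar> < e"
proof -
  define W where "W z = f -` {f z - e/2<..<f z + e/2}" for z
  have opn: "open (W z)" for z
    unfolding W_def by (rule open_vimage[OF open_greaterThanLessThan cont])
  have mem: "z \<in> W z" for z
    using \<open>0 < e\<close> by (simp add: W_def)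
  obtain d where d: "0 < d" and sub: "\<And>x. x \<in> closure {x. f x \<noteq> 0} \<Longrightarrow> \<exists>G\<in>range W. ball x d \<subseteq> G"
  proof (rule Heine_Borel_lemma[OF supp])
    show "closure {x. f x \<noteq> 0} \<subseteq> \<Union> (range W)"
      using mem by blast
    show "open G" if "G \<in> range W" for G
      using that opn by blast
  qed blast
  have near: "\<bar>f x - f y\<bar> < e" if "dist x y < d" "f x \<noteq> 0" for x y
  proof -
    have "x \<in> closure {x. f x \<noteq> 0}"
      using that(2) by (intro subsetD[OF closure_subset]) simp
    then obtain z where "ball x d \<subseteq> W z"
      using sub by blast
    moreover have "x \<in> ball x d" "y \<in> ball x d"
      using that(1) d by auto
    ultimately have "x \<in> W z" "y \<in> W z"
      by blast+
    then show ?thesis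
      by (auto simp: W_def)
  qed
  have "\<bar>f x - f y\<bar> < e" if "dist x y < d" for x y
  proof (cases "f x = 0 \<and> f y = 0")
    case False
    then show ?thesis
      using near[of x y] near[of y x] that by (auto simp: dist_commute abs_minus_commute)
  qed (use \<open>0 < e\<close> in simp)
  with d that show ?thesis
    by blast
qed

lemma borel_measurable_recip [measurable]: "recip \<in> borel_measurable borel"
  by (intro borel_measurable_continuous_onI continuous_on_recip)

lemma continuous_on_Rep_unit_ivl: "continuous_on A Rep_unit_ivl"
  unfolding continuous_on_iff dist_Rep_unit_ivl by auto

lemma borel_measurable_Rep_unit_ivl [measurable]: "Rep_unit_ivl \<in> borel_measurable borel"
  by (intro borel_measurable_continuous_onI continuous_on_Rep_unit_ivl)

lemma borel_measurable_recip_snd [measurable]: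
  "(\<lambda>z::unit_ivl \<times> rplus. recip (snd z)) \<in> borel_measurable borel"
  by (intro borel_measurable_continuous_onI continuous_on_compose2[OF continuous_on_recip] continuous_intros) auto

lemma recip_nonneg: "0 \<le> recip x"
  by (cases x rule: recip_cases) auto

lemma ray_eq_recip: "0 < t \<Longrightarrow> ray t = {x. recip x \<le> 1 / t}"
  by (auto simp: ray_def recip_le_iff)

lemma UNIV_times_ray_eq: "0 < t \<Longrightarrow> UNIV \<times> ray t = {z::unit_ivl \<times> rplus. recip (snd z) \<le> 1 / t}"
  by (auto simp: ray_eq_recip)

lemma UNIV_times_ray_borel: "0 < t \<Longrightarrow> (UNIV \<times> ray t :: (unit_ivl \<times> rplus) set) \<in> sets borel"
  unfolding UNIV_times_ray_eq by measurable

lemma sets_dirac_sum [simp]: "sets (dirac_sum I x) = sets borel"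
  by (simp add: dirac_sum_def)

lemma space_dirac_sum [simp]: "space (dirac_sum I x) = UNIV"
  by (simp add: dirac_sum_def)

lemma emeasure_dirac_sum:
  "B \<in> sets borel \<Longrightarrow> emeasure (dirac_sum I x) B = emeasure (count_space I) {i\<in>I. x i \<in> B}"
  unfolding dirac_sum_def by (subst emeasure_distr) (auto intro!: arg_cong[where f="emeasure _"])

lemma sets_of_point_measure: "m \<in> point_measures \<Longrightarrow> sets m = sets borel"
  by (auto simp: point_measures_def)

lemma point_measure_locally_finite:
  assumes "m \<in> point_measures"
  shows "emeasure m {z. recip (snd z) < u} < \<infinity>"
proof (cases "0 < u")
  case True
  have "emeasure m {z. recip (snd z) < u} \<le> emeasure m (UNIV \<times> ray (1/u))"
    using True by (intro emeasure_mono) (auto simp: sets_of_point_measure[OF assms] ray_eq_recip intro!: borel_Times)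
  also have "\<dots> < \<infinity>"
    using assms True by (auto simp: point_measures_def)
  finally show ?thesis .
next
  case False
  then have "{z::unit_ivl \<times> rplus. recip (snd z) < u} = {}"
    using recip_nonneg by (auto simp: not_less intro: order_trans)
  then show ?thesis by simp
qed

text \<open>
  Locally finite point measures take natural numbers as values on relatively compact sets; the floor
  merely turns such a value into an element of \<open>nat\<close>.
\<close>

definition cnt :: "'a measure \<Rightarrow> 'a set \<Rightarrow> nat" where
  "cnt \<xi> B = nat \<lfloor>measure \<xi> B\<rfloor>"

lemma cnt_eqI:
  assumes "emeasure \<xi> B = of_nat k"
  shows "cnt \<xi> B = k"
  using assms by (simp add: cnt_def measure_def)

lemma emeasure_eq_cnt:
  assumes m: "m \<in> point_measures" and B: "B \<in> sets borel" "B \<subseteq> {z. recip (snd z) < u}"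
  shows "emeasure m B = of_nat (cnt m B)"
proof -
  obtain I :: "nat set" and x where mI: "m = dirac_sum I x"
    using m by (auto simp: point_measures_def)
  have "emeasure m B \<le> emeasure m {z. recip (snd z) < u}"
    using B by (intro emeasure_mono) (auto simp: sets_of_point_measure[OF m])
  then have "emeasure m B < \<infinity>"
    using point_measure_locally_finite[OF m, of u] by simp
  then have "finite {i\<in>I. x i \<in> B}"
    unfolding mI emeasure_dirac_sum[OF B(1)] by (subst (asm) emeasure_count_space) (auto split: if_splits)
  then have "emeasure m B = of_nat (card {i\<in>I. x i \<in> B})"
    unfolding mI emeasure_dirac_sum[OF B(1)] by (subst emeasure_count_space) auto
  then show ?thesis
    using cnt_eqI by metis
qed

lemma measure_eq_cnt:
  assumes "m \<in> point_measures" "B \<in> sets borel" "B \<subseteq> {z. recip (snd z) < u}"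
  shows "measure m B = of_nat (cnt m B)"
  using emeasure_eq_cnt[OF assms] by (simp add: measure_def)

section \<open>Cells and their counts\<close>

text \<open>
  Floors give half-open intervals, so the cells at one level are disjoint by construction.
  On \<open>(0, \<infinity>]\<close> the coordinate \<open>recip\<close> is cut: it is an isometry, and \<open>\<infinity>\<close> lies in the cell with index \<open>0\<close>.
\<close>

definition unit_cell :: "real \<Rightarrow> nat \<Rightarrow> nat \<Rightarrow> unit_ivl set" where
  "unit_cell \<theta> m i = {x. \<lfloor>real m * Rep_unit_ivl x + \<theta>\<rfloor> = int i}"

definition ray_cell :: "nat \<Rightarrow> nat \<Rightarrow> rplus set" where
  "ray_cell m l = {y. \<lfloor>real m * recip y\<rfloor> = int l}"

definition cell :: "real \<Rightarrow> nat \<Rightarrow> nat \<times> nat \<Rightarrow> (unit_ivl \<times> rplus) set" where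
  "cell \<theta> m k = unit_cell \<theta> m (fst k) \<times> ray_cell m (snd k)"

text \<open>
  An offset \<open>\<theta>\<close> below \<open>1\<close> lets the floor of \<open>m * x + \<theta>\<close> reach \<open>m\<close>, hence \<open>m + 1\<close> cells on the unit interval;
  the \<open>m * m\<close> cells on the other axis are those with \<open>recip\<close> below \<open>m\<close>.
\<close>

definition grid :: "nat \<Rightarrow> (nat \<times> nat) set" where
  "grid m = {..m} \<times> {..<m * m}"

lemma finite_grid [simp]: "finite (grid m)"
  by (simp add: grid_def)

lemma unit_cell_borel [measurable, simp]: "unit_cell \<theta> m i \<in> sets borel"
  unfolding unit_cell_def by measurable

lemma ray_cell_borel [measurable, simp]: "ray_cell m l \<in> sets borel"
  unfolding ray_cell_def by measurable

lemma cell_borel [measurable, simp]: "cell \<theta> m k \<in> sets borel"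
  unfolding cell_def by (intro borel_Times) simp_all

lemma cell_disjoint: "z \<in> cell \<theta> m k \<Longrightarrow> z \<in> cell \<theta> m k' \<Longrightarrow> k = k'"
  by (auto simp: cell_def unit_cell_def ray_cell_def prod_eq_iff)

lemma disjoint_family_cell: "disjoint_family_on (cell \<theta> m) K"
  using cell_disjoint by (fastforce simp: disjoint_family_on_def)

lemma cell_dist:
  assumes "z \<in> cell \<theta> m k" "w \<in> cell \<theta> m k" "0 < m"
  shows "\<bar>recip (snd z) - recip (snd w)\<bar> < 1 / m" "dist z w < 2 / m"
proof -
  have *: "\<bar>a - b\<bar> < 1 / m" if "\<lfloor>real m * a + s\<rfloor> = \<lfloor>real m * b + s\<rfloor>" for a b s
  proof -
    have "\<bar>(real m * a + s) - (real m * b + s)\<bar> < 1"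
      using that by linarith
    then have "m * \<bar>a - b\<bar> < 1"
      by (simp add: abs_mult flip: right_diff_distrib)
    then show ?thesis
      using \<open>0 < m\<close> by (simp add: field_simps)
  qed
  show r: "\<bar>recip (snd z) - recip (snd w)\<bar> < 1 / m"
    using *[of "recip (snd z)" 0 "recip (snd w)"] assms by (auto simp: cell_def unit_cell_def ray_cell_def)
  have l: "\<bar>Rep_unit_ivl (fst z) - Rep_unit_ivl (fst w)\<bar> < 1 / m"
    using *[of "Rep_unit_ivl (fst z)" \<theta> "Rep_unit_ivl (fst w)"] assms by (auto simp: cell_def unit_cell_def ray_cell_def)
  have "dist z w \<le> dist (fst z) (fst w) + dist (snd z) (snd w)"
    unfolding dist_prod_def by (rule sqrt_sum_squares_le_sum) auto
  with l r show "dist z w < 2 / m"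
    by (simp add: dist_rplus_def dist_unit_ivl_def)
qed

lemma cell_cover:
  assumes "0 \<le> \<theta>" "\<theta> < 1" "recip (snd z) < m"
  shows "\<exists>k\<in>grid m. z \<in> cell \<theta> m k"
proof -
  let ?a = "\<lfloor>real m * Rep_unit_ivl (fst z) + \<theta>\<rfloor>" and ?b = "\<lfloor>real m * recip (snd z)\<rfloor>"
  have m: "0 < m"
    using assms(3) recip_nonneg[of "snd z"] by simp
  have R: "0 \<le> Rep_unit_ivl (fst z)" "Rep_unit_ivl (fst z) \<le> 1"
    using Rep_unit_ivl[of "fst z"] by auto
  have "real m * Rep_unit_ivl (fst z) \<le> m"
    using R m by (simp add: mult_left_le)
  then have a: "0 \<le> ?a" "?a \<le> int m"
    using R assms by (auto simp: floor_le_iff)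
  have "real m * recip (snd z) < real m * real m"
    using m assms(3) by simp
  then have b: "0 \<le> ?b" "?b < int (m * m)"
    using recip_nonneg[of "snd z"] by (auto simp: floor_less_iff)
  have "nat ?b < m * m"
    using b by (metis nat_less_iff)
  then have "(nat ?a, nat ?b) \<in> grid m"
    using a by (auto simp: grid_def)
  moreover have "z \<in> cell \<theta> m (nat ?a, nat ?b)"
    using a b by (simp add: cell_def unit_cell_def ray_cell_def mem_Times_iff)
  ultimately show ?thesis ..
qed

lemma cell_subset:
  assumes "k \<in> grid m"
  shows "cell \<theta> m k \<subseteq> {z. recip (snd z) < m}"
proof
  fix z assume z: "z \<in> cell \<theta> m k"
  have m: "0 < m" using assms by (auto simp: grid_def intro!: Nat.gr0I)
  have "\<lfloor>real m * recip (snd z)\<rfloor> < int (m * m)"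
    using z assms by (auto simp: cell_def unit_cell_def ray_cell_def grid_def simp flip: of_nat_mult)
  then have "real m * recip (snd z) < real m * real m"
    by (simp add: floor_less_iff)
  then show "z \<in> {z. recip (snd z) < m}"
    using m by simp
qed

text \<open>
  The error of replacing \<open>f\<close> by a step function is controlled by the cell masses alone. Two measures
  with equal cell masses therefore have nearly equal integrals of \<open>f\<close>.
\<close>

lemma integral_near_step_function:
  fixes f :: "'a \<Rightarrow> real"
  assumes f: "f \<in> borel_measurable M" and K: "finite K" "disjoint_family_on C K"
    and C: "\<And>k. k \<in> K \<Longrightarrow> C k \<in> sets M" "\<And>k. k \<in> K \<Longrightarrow> emeasure M (C k) < \<infinity>"
    and near: "\<And>k z. k \<in> K \<Longrightarrow> z \<in> C k \<Longrightarrow> \<bar>f z - w k\<bar> \<le> e"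
    and out: "\<And>z. z \<in> space M \<Longrightarrow> z \<notin> (\<Union>k\<in>K. C k) \<Longrightarrow> f z = 0"
  shows "\<bar>(\<integral>z. f z \<partial>M) - (\<Sum>k\<in>K. w k * measure M (C k))\<bar> \<le> e * (\<Sum>k\<in>K. measure M (C k))"
proof -
  define g where "g z = (\<Sum>k\<in>K. w k * indicator (C k) z)" for z
  define h where "h z = (\<Sum>k\<in>K. e * indicator (C k) z)" for z
  have int: "integrable M (\<lambda>z. a * indicator (C k) z)" if "k \<in> K" for k and a :: real
    using C[OF that] by (intro integrable_mult_right integrable_real_indicator)
  have g: "integrable M g" and h: "integrable M h"
    unfolding g_def h_def using int by (auto intro!: Bochner_Integration.integrable_sum)
  have ig: "(\<integral>z. g z \<partial>M) = (\<Sum>k\<in>K. w k * measure M (C k))"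
    unfolding g_def using int C by (subst Bochner_Integration.integral_sum) (auto intro!: sum.cong)
  have ih: "(\<integral>z. h z \<partial>M) = e * (\<Sum>k\<in>K. measure M (C k))"
    unfolding h_def using int C by (subst Bochner_Integration.integral_sum) (auto intro!: sum.cong simp: sum_distrib_left)
  have bd: "\<bar>f z - g z\<bar> \<le> h z" if "z \<in> space M" for z
  proof (cases "z \<in> (\<Union>k\<in>K. C k)")
    case True
    then obtain k where k: "k \<in> K" "z \<in> C k" by blast
    have "indicator (C k') z = (if k' = k then 1 else 0 :: real)" if "k' \<in> K" for k'
      using K(2) k that by (auto simp: disjoint_family_on_def indicator_def)
    then have "(\<Sum>k'\<in>K. a k' * indicator (C k') z) = (\<Sum>k'\<in>K. if k' = k then a k' else 0)" for a :: "'b \<Rightarrow> real"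
      by (intro sum.cong) auto
    then have *: "(\<Sum>k'\<in>K. a k' * indicator (C k') z) = a k" for a :: "'b \<Rightarrow> real"
      using k K(1) by simp
    show ?thesis
      using near[OF k] unfolding g_def h_def * by simp
  next
    case False
    then have "g z = 0" "h z = 0"
      by (auto simp: g_def h_def indicator_def)
    then show ?thesis
      using out[OF that False] by simp
  qed
  have fg: "integrable M (\<lambda>z. f z - g z)"
    using f g bd by (intro Bochner_Integration.integrable_bound[OF h]) (auto intro!: AE_I2 order_trans[OF bd])
  have "integrable M f"
    using Bochner_Integration.integrable_add[OF fg g] by simp
  then have "\<bar>(\<integral>z. f z \<partial>M) - (\<integral>z. g z \<partial>M)\<bar> = \<bar>\<integral>z. f z - g z \<partial>M\<bar>"
    using g by simp
  also have "\<dots> \<le> (\<integral>z. \<bar>f z - g z\<bar> \<partial>M)"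
    by (rule integral_abs_bound)
  also have "\<dots> \<le> (\<integral>z. h z \<partial>M)"
    using fg h bd by (intro integral_mono) auto
  finally show ?thesis
    unfolding ig ih .
qed

lemma CK_plus_vanishes:
  assumes "f \<in> (CK_plus :: (unit_ivl \<times> rplus \<Rightarrow> real) set)"
  obtains r where "0 < r" "\<And>z. f z \<noteq> 0 \<Longrightarrow> recip (snd z) \<le> r"
proof -
  have "compact (snd ` closure {z. f z \<noteq> 0})"
    using assms by (intro compact_continuous_image continuous_intros) (auto simp: CK_plus_def)
  then obtain t where t: "0 < t" "snd ` closure {z. f z \<noteq> 0} \<subseteq> ray t"
    by (rule compact_rplus_subset_ray)
  have "recip (snd z) \<le> 1 / t" if "f z \<noteq> 0" for z
    using t that closure_subset[of "{z. f z \<noteq> 0}"] by (auto simp: ray_eq_recip)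
  then show ?thesis
    using t(1) that[of "1/t"] by simp
qed

section \<open>Equal counts at all levels force vague convergence\<close>

text \<open>
  Only cells that meet the support of \<open>f\<close> matter. For large \<open>m\<close> they stay inside a fixed region
  \<open>recip < r + 1\<close>, whose \<open>\<xi>\<close>-mass \<open>H\<close> bounds their total mass, and on each of them \<open>f\<close> is
  nearly constant. Both integrals are thus close to the same sum over cells.
\<close>

lemma integral_tendsto_of_same_counts:
  assumes f: "f \<in> CK_plus" and \<theta>: "0 \<le> \<theta>" "\<theta> < 1"
    and \<xi>: "\<xi> \<in> point_measures" and \<eta>: "\<And>m. \<eta> m \<in> point_measures"
    and same: "\<And>m k. k \<in> grid m \<Longrightarrow> cnt (\<eta> m) (cell \<theta> m k) = cnt \<xi> (cell \<theta> m k)"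
  shows "(\<lambda>m. \<integral>z. f z \<partial>\<eta> m) \<longlonglongrightarrow> (\<integral>z. f z \<partial>\<xi>)"
proof (rule LIMSEQ_I)
  fix e :: real assume e: "0 < e"
  obtain r where r: "0 < r" "\<And>z. f z \<noteq> 0 \<Longrightarrow> recip (snd z) \<le> r"
    using CK_plus_vanishes[OF f] by blast
  define H where "H = measure \<xi> {z. recip (snd z) < r + 1}"
  \<comment> \<open>The denominator is positive even if \<open>H = 0\<close>, and \<open>2 * e' * H < e\<close>.\<close>
  define e' where "e' = e / (2 * H + 1)"
  have H: "0 \<le> H" by (simp add: H_def)
  have e': "0 < e'" "2 * (e' * H) < e"
    using e H by (auto simp: e'_def field_simps)
  have f': "continuous_on UNIV f" "compact (closure {z. f z \<noteq> 0})"
    using f by (auto simp: CK_plus_def)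
  obtain d where d: "0 < d" "\<And>x y. dist x y < d \<Longrightarrow> \<bar>f x - f y\<bar> < e'"
    using compact_support_uniformly_continuous[OF f' e'(1)] by blast
  obtain m0 :: nat where m0: "2 / d < m0" "r + 1 < m0"
    using reals_Archimedean2[of "max (2/d) (r+1)"] by auto
  have "norm ((\<integral>z. f z \<partial>\<eta> m) - (\<integral>z. f z \<partial>\<xi>)) < e" if "m0 \<le> m" for m
  proof -
    have m: "0 < m" "2 / m < d" "r + 1 < m" "1 \<le> m"
      using m0 that d(1) r(1) by (auto simp: field_simps intro: less_le_trans)
    \<comment> \<open>The cells that meet the support, each with a point of the support in it.\<close>
    define K where "K = {k \<in> grid m. \<exists>z\<in>cell \<theta> m k. f z \<noteq> 0}"
    define z0 where "z0 k = (SOME z. z \<in> cell \<theta> m k \<and> f z \<noteq> 0)" for k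
    have z0: "z0 k \<in> cell \<theta> m k" "f (z0 k) \<noteq> 0" if "k \<in> K" for k
      using someI_ex[of "\<lambda>z. z \<in> cell \<theta> m k \<and> f z \<noteq> 0"] that by (auto simp: z0_def K_def)
    have K: "finite K" "disjoint_family_on (cell \<theta> m) K"
      by (auto simp: K_def disjoint_family_cell)
    have step: "\<bar>(\<integral>z. f z \<partial>\<tau>) - (\<Sum>k\<in>K. f (z0 k) * measure \<tau> (cell \<theta> m k))\<bar>
        \<le> e' * (\<Sum>k\<in>K. measure \<tau> (cell \<theta> m k))" if \<tau>: "\<tau> \<in> point_measures" for \<tau>
    proof (rule integral_near_step_function[OF _ K])
      show "f \<in> borel_measurable \<tau>"
        using borel_measurable_continuous_onI[OF f'(1)] sets_of_point_measure[OF \<tau>]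
        by (simp cong: measurable_cong_sets)
      show "cell \<theta> m k \<in> sets \<tau>" for k
        by (simp add: sets_of_point_measure[OF \<tau>])
      show "emeasure \<tau> (cell \<theta> m k) < \<infinity>" if "k \<in> K" for k
        using emeasure_eq_cnt[OF \<tau> cell_borel cell_subset[of k m \<theta>]] that
        by (simp add: K_def of_nat_less_top)
      show "\<bar>f z - f (z0 k)\<bar> \<le> e'" if "k \<in> K" "z \<in> cell \<theta> m k" for k z
        using cell_dist(2)[OF that(2) z0(1)[OF that(1)] m(1)] m(2) d(2) by (meson less_trans less_imp_le)
      show "f z = 0" if "z \<notin> (\<Union>k\<in>K. cell \<theta> m k)" for z
      proof (rule ccontr)
        assume nz: "f z \<noteq> 0"
        then have "recip (snd z) < m"
          using r(2)[of z] m(3) by simp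
        then obtain k where "k \<in> grid m" "z \<in> cell \<theta> m k"
          using cell_cover[OF \<theta>] by blast
        then have "k \<in> K"
          using nz unfolding K_def by blast
        with \<open>z \<in> cell \<theta> m k\<close> that show False
          by blast
      qed
    qed
    have same': "measure (\<eta> m) (cell \<theta> m k) = measure \<xi> (cell \<theta> m k)" if "k \<in> K" for k
      using that measure_eq_cnt[OF \<eta> cell_borel cell_subset[of k m \<theta>]]
        measure_eq_cnt[OF \<xi> cell_borel cell_subset[of k m \<theta>]] same[of k m]
      by (simp add: K_def)
    have "(\<Sum>k\<in>K. measure \<xi> (cell \<theta> m k)) = measure \<xi> (\<Union>k\<in>K. cell \<theta> m k)"
    proof (rule measure_finite_Union[symmetric, OF K(1) _ K(2)])
      show "cell \<theta> m ` K \<subseteq> sets \<xi>"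
        by (auto simp: sets_of_point_measure[OF \<xi>])
      show "emeasure \<xi> (cell \<theta> m k) \<noteq> \<infinity>" if "k \<in> K" for k
        using emeasure_eq_cnt[OF \<xi> cell_borel cell_subset[of k m \<theta>]] that
        by (simp add: K_def of_nat_less_top)
    qed
    also have "\<dots> \<le> H"
      unfolding H_def
    proof (rule measure_mono_fmeasurable)
      show "(\<Union>k\<in>K. cell \<theta> m k) \<subseteq> {z. recip (snd z) < r + 1}"
      proof safe
        fix x y k assume k: "k \<in> K" "(x, y) \<in> cell \<theta> m k"
        have "\<bar>recip y - recip (snd (z0 k))\<bar> < 1 / m"
          using cell_dist(1)[OF k(2) z0(1)[OF k(1)] m(1)] by simp
        moreover have "1 / m \<le> 1"
          using m(4) by simp
        ultimately show "recip (snd (x, y)) < r + 1"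
          using r(2)[OF z0(2)[OF k(1)]] by simp
      qed
      show "(\<Union>k\<in>K. cell \<theta> m k) \<in> sets \<xi>"
        using K by (auto simp: sets_of_point_measure[OF \<xi>])
      show "{z. recip (snd z) < r + 1} \<in> fmeasurable \<xi>"
        using point_measure_locally_finite[OF \<xi>] by (intro fmeasurableI) (auto simp: sets_of_point_measure[OF \<xi>])
    qed
    finally have le: "e' * (\<Sum>k\<in>K. measure \<xi> (cell \<theta> m k)) \<le> e' * H"
      using e'(1) by simp
    have near: "\<bar>b - a\<bar> < e" if "\<bar>a - x\<bar> \<le> p" "\<bar>b - x\<bar> \<le> p" "p \<le> e' * H" for a b x p :: real
      using that e'(2) by linarith
    have eq: "(\<Sum>k\<in>K. f (z0 k) * measure (\<eta> m) (cell \<theta> m k)) = (\<Sum>k\<in>K. f (z0 k) * measure \<xi> (cell \<theta> m k))"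
      "(\<Sum>k\<in>K. measure (\<eta> m) (cell \<theta> m k)) = (\<Sum>k\<in>K. measure \<xi> (cell \<theta> m k))"
      by (intro sum.cong refl, simp only: same')+
    show ?thesis
      unfolding real_norm_def by (rule near[OF step[OF \<xi>] step[OF \<eta>[of m], unfolded eq] le])
  qed
  then show "\<exists>no. \<forall>n\<ge>no. norm ((\<integral>z. f z \<partial>\<eta> n) - (\<integral>z. f z \<partial>\<xi>)) < e"
    by blast
qed

lemma topspace_vague [simp]: "topspace vague_topology = point_measures"
proof -
  have "(\<lambda>_. 0) \<in> CK_plus"
    by (simp add: CK_plus_def)
  then have "point_measures \<in> {{m \<in> point_measures. (\<integral>z. f z \<partial>m) \<in> U} | f U. f \<in> CK_plus \<and> open U}"
    by (intro CollectI exI[of _ "\<lambda>_. 0"] exI[of _ UNIV]) auto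
  then show ?thesis
    unfolding vague_topology_def topology_generated_by_topspace by blast
qed

text \<open>
  It suffices to look at the subbasis that generates the topology, since the property of eventually
  entering every such neighbourhood of \<open>\<xi>\<close> passes to finite intersections and arbitrary unions.
\<close>

lemma limitin_vague:
  assumes "\<xi> \<in> point_measures" "\<And>m. \<eta> m \<in> point_measures"
    and conv: "\<And>f. f \<in> CK_plus \<Longrightarrow> (\<lambda>m. \<integral>z. f z \<partial>\<eta> m) \<longlonglongrightarrow> (\<integral>z. f z \<partial>\<xi>)"
  shows "limitin vague_topology \<eta> \<xi> sequentially"
proof -
  have "eventually (\<lambda>m. \<eta> m \<in> U) sequentially"
    if "generate_topology_on {{m \<in> point_measures. (\<integral>z. f z \<partial>m) \<in> U} | f U. f \<in> CK_plus \<and> open U} U" "\<xi> \<in> U" for U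
    using that
  proof induction
    case (Int a b)
    then show ?case by (auto intro: eventually_conj)
  next
    case (UN K)
    then obtain k where "k \<in> K" "\<xi> \<in> k" by blast
    with UN(2) have "eventually (\<lambda>m. \<eta> m \<in> k) sequentially" by blast
    then show ?case by (rule eventually_mono) (use \<open>k \<in> K\<close> in blast)
  next
    case (Basis s)
    then obtain f V where s: "s = {m \<in> point_measures. (\<integral>z. f z \<partial>m) \<in> V}" "f \<in> CK_plus" "open V"
      by blast
    have "eventually (\<lambda>m. (\<integral>z. f z \<partial>\<eta> m) \<in> V) sequentially"
      using Basis(2) by (intro topological_tendstoD[OF conv[OF s(2)] s(3)]) (simp add: s(1))
    then show ?case
      by (rule eventually_mono) (simp add: s(1) assms(2))
  qed simp
  moreover have "generate_topology_on {{m \<in> point_measures. (\<integral>z. f z \<partial>m) \<in> U} | f U. f \<in> CK_plus \<and> open U} U"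
    if "openin vague_topology U" for U
    using that unfolding vague_topology_def by (rule openin_topology_generated_by)
  ultimately show ?thesis
    using assms(1) by (simp add: limitin_def)
qed

section \<open>From generating functions to laws of count vectors\<close>

text \<open>
  After the terms below \<open>v\<close> have been removed and \<open>s ^ v\<close> divided out, a generating function at small \<open>s\<close>
  differs from its coefficient of index \<open>v\<close> by at most \<open>s\<close>. The bound does not depend on the
  law, which is what makes the passage to the limit uniform.
\<close>

lemma pgf_coefficient_error:
  fixes W :: "'a \<Rightarrow> real" and Y :: "'a \<Rightarrow> nat"
  assumes "prob_space M" and [measurable]: "W \<in> borel_measurable M" "Y \<in> M \<rightarrow>\<^sub>M count_space UNIV"
    and W: "\<And>\<omega>. 0 \<le> W \<omega>" "\<And>\<omega>. W \<omega> \<le> 1" and s: "0 < s" "s < 1"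
  shows "\<bar>((\<integral>\<omega>. W \<omega> * s ^ Y \<omega> \<partial>M) - (\<Sum>u<v. s ^ u * (\<integral>\<omega>. W \<omega> * of_bool (Y \<omega> = u) \<partial>M))) / s ^ v
           - (\<integral>\<omega>. W \<omega> * of_bool (Y \<omega> = v) \<partial>M)\<bar> \<le> s"
proof -
  interpret prob_space M by fact
  let ?E = "\<lambda>u. \<integral>\<omega>. W \<omega> * of_bool (Y \<omega> = u) \<partial>M"
  have int1: "integrable M (\<lambda>\<omega>. W \<omega> * s ^ Y \<omega>)"
  proof (rule integrable_const_bound[where B=1])
    show "AE \<omega> in M. norm (W \<omega> * s ^ Y \<omega>) \<le> 1"
      using W s by (intro AE_I2) (auto simp: abs_mult intro!: mult_le_one power_le_one)
  qed measurable
  have int2: "integrable M (\<lambda>\<omega>. W \<omega> * of_bool (Y \<omega> = u))" for u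
    using W by (intro integrable_const_bound[where B=1]) auto
  have int3: "integrable M (\<lambda>\<omega>. \<Sum>u<Suc v. s ^ u * (W \<omega> * of_bool (Y \<omega> = u)))"
    using int2 by auto
  have bd: "\<bar>W \<omega> * s ^ Y \<omega> - (\<Sum>u<Suc v. s ^ u * (W \<omega> * of_bool (Y \<omega> = u)))\<bar> \<le> s ^ Suc v" for \<omega>
  proof -
    have "(\<Sum>u<Suc v. s ^ u * (W \<omega> * of_bool (Y \<omega> = u))) = (\<Sum>u<Suc v. if Y \<omega> = u then W \<omega> * s ^ u else 0)"
      by (intro sum.cong) auto
    also have "\<dots> = (if Y \<omega> < Suc v then W \<omega> * s ^ Y \<omega> else 0)"
      by (simp add: sum.delta)
    finally have "\<bar>W \<omega> * s ^ Y \<omega> - (\<Sum>u<Suc v. s ^ u * (W \<omega> * of_bool (Y \<omega> = u)))\<bar>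
        = (if Y \<omega> < Suc v then 0 else W \<omega> * s ^ Y \<omega>)"
      using W s by (auto simp: abs_mult)
    also have "\<dots> \<le> s ^ Suc v"
    proof (cases "Y \<omega> < Suc v")
      case False
      then have "W \<omega> * s ^ Y \<omega> \<le> 1 * s ^ Suc v"
        using W s by (intro mult_mono power_decreasing) auto
      with False show ?thesis by simp
    qed (use s in simp)
    finally show ?thesis .
  qed
  have "(\<integral>\<omega>. (\<Sum>u<Suc v. s ^ u * (W \<omega> * of_bool (Y \<omega> = u))) \<partial>M) = (\<Sum>u<Suc v. s ^ u * ?E u)"
    by (subst Bochner_Integration.integral_sum) (use int2 in auto)
  then have "\<bar>(\<integral>\<omega>. W \<omega> * s ^ Y \<omega> \<partial>M) - (\<Sum>u<Suc v. s ^ u * ?E u)\<bar>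
      = \<bar>\<integral>\<omega>. W \<omega> * s ^ Y \<omega> - (\<Sum>u<Suc v. s ^ u * (W \<omega> * of_bool (Y \<omega> = u))) \<partial>M\<bar>"
    using Bochner_Integration.integral_diff[OF int1 int3] by simp
  also have "\<dots> \<le> (\<integral>\<omega>. s ^ Suc v \<partial>M)"
    using int1 int3 bd
    by (intro order_trans[OF integral_abs_bound] integral_mono integrable_abs Bochner_Integration.integrable_diff) auto
  also have "\<dots> = s ^ Suc v"
    by (simp add: prob_space)
  finally have "\<bar>((\<integral>\<omega>. W \<omega> * s ^ Y \<omega> \<partial>M) - (\<Sum>u<v. s ^ u * ?E u) - s ^ v * ?E v) / s ^ v\<bar> \<le> s"
    using s by (simp add: abs_divide divide_le_eq mult.commute diff_diff_eq)
  then show ?thesis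
    using s by (simp add: diff_divide_distrib)
qed

text \<open>
  Coefficients are extracted one after the other: for each fixed \<open>s\<close> the approximation of the previous
  lemma converges, with an error at most \<open>s\<close> on both sides, and \<open>s\<close> is arbitrary.
  The weight \<open>W\<close> carries along the other coordinates of a random vector.
\<close>

lemma tendsto_atom_of_pgf:
  fixes W :: "nat \<Rightarrow> 'a \<Rightarrow> real" and Y :: "nat \<Rightarrow> 'a \<Rightarrow> nat" and W' :: "'b \<Rightarrow> real" and Y' :: "'b \<Rightarrow> nat"
  assumes M: "prob_space M" "\<And>n. W n \<in> borel_measurable M" "\<And>n. Y n \<in> M \<rightarrow>\<^sub>M count_space UNIV"
      "\<And>n \<omega>. 0 \<le> W n \<omega>" "\<And>n \<omega>. W n \<omega> \<le> 1"
    and N: "prob_space N" "W' \<in> borel_measurable N" "Y' \<in> N \<rightarrow>\<^sub>M count_space UNIV"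
      "\<And>\<omega>. 0 \<le> W' \<omega>" "\<And>\<omega>. W' \<omega> \<le> 1"
    and pgf: "\<And>s. 0 < s \<Longrightarrow> s < 1 \<Longrightarrow>
      (\<lambda>n. \<integral>\<omega>. W n \<omega> * s ^ Y n \<omega> \<partial>M) \<longlonglongrightarrow> (\<integral>\<omega>. W' \<omega> * s ^ Y' \<omega> \<partial>N)"
  shows "(\<lambda>n. \<integral>\<omega>. W n \<omega> * of_bool (Y n \<omega> = v) \<partial>M) \<longlonglongrightarrow> (\<integral>\<omega>. W' \<omega> * of_bool (Y' \<omega> = v) \<partial>N)"
proof (induction v rule: less_induct)
  case (less v)
  let ?E = "\<lambda>n u. \<integral>\<omega>. W n \<omega> * of_bool (Y n \<omega> = u) \<partial>M"
  let ?E' = "\<lambda>u. \<integral>\<omega>. W' \<omega> * of_bool (Y' \<omega> = u) \<partial>N"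
  show ?case
  proof (rule LIMSEQ_I)
    fix e :: real assume e: "0 < e"
    \<comment> \<open>Three errors of size at most \<open>s\<close> have to add up to at most \<open>e\<close>.\<close>
    define s where "s = min (1/2) (e/3)"
    have s: "0 < s" "s < 1" "3 * s \<le> e"
      using e by (auto simp: s_def)
    let ?R = "\<lambda>n. ((\<integral>\<omega>. W n \<omega> * s ^ Y n \<omega> \<partial>M) - (\<Sum>u<v. s ^ u * ?E n u)) / s ^ v"
    let ?R' = "((\<integral>\<omega>. W' \<omega> * s ^ Y' \<omega> \<partial>N) - (\<Sum>u<v. s ^ u * ?E' u)) / s ^ v"
    have "?R \<longlonglongrightarrow> ?R'"
      using s less by (intro tendsto_intros pgf) auto
    then obtain n0 where n0: "\<And>n. n \<ge> n0 \<Longrightarrow> \<bar>?R n - ?R'\<bar> < s"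
      using s(1) unfolding LIMSEQ_iff real_norm_def by blast
    have three: "\<bar>a - b\<bar> < e" if "\<bar>r - a\<bar> \<le> s" "\<bar>r' - b\<bar> \<le> s" "\<bar>r - r'\<bar> < s" for a b r r' :: real
      using that s(3) by linarith
    have "norm (?E n v - ?E' v) < e" if "n \<ge> n0" for n
      unfolding real_norm_def
      by (rule three[OF pgf_coefficient_error[OF M(1-5) s(1,2)] pgf_coefficient_error[OF N s(1,2)] n0[OF that]])
    then show "\<exists>no. \<forall>n\<ge>no. norm (?E n v - ?E' v) < e"
      by blast
  qed
qed

text \<open>
  Coordinates are switched from \<open>s i ^ Y i\<close> to the indicator of \<open>Y i = v i\<close> one at a time; the remaining
  factors form the weight of the previous lemma.
\<close>

lemma tendsto_joint_atom_of_pgf: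
  fixes Y :: "nat \<Rightarrow> 'i \<Rightarrow> 'a \<Rightarrow> nat" and Y' :: "'i \<Rightarrow> 'b \<Rightarrow> nat" and v :: "'i \<Rightarrow> nat"
  assumes M: "prob_space M" "\<And>n i. i \<in> I \<Longrightarrow> Y n i \<in> M \<rightarrow>\<^sub>M count_space UNIV"
    and N: "prob_space N" "\<And>i. i \<in> I \<Longrightarrow> Y' i \<in> N \<rightarrow>\<^sub>M count_space UNIV"
    and I: "finite I"
    and pgf: "\<And>s :: 'i \<Rightarrow> real. (\<And>i. i \<in> I \<Longrightarrow> 0 < s i \<and> s i < 1) \<Longrightarrow>
      (\<lambda>n. \<integral>\<omega>. (\<Prod>i\<in>I. s i ^ Y n i \<omega>) \<partial>M) \<longlonglongrightarrow> (\<integral>\<omega>. (\<Prod>i\<in>I. s i ^ Y' i \<omega>) \<partial>N)"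
  shows "(\<lambda>n. \<integral>\<omega>. (\<Prod>i\<in>I. of_bool (Y n i \<omega> = v i)) \<partial>M) \<longlonglongrightarrow> (\<integral>\<omega>. (\<Prod>i\<in>I. of_bool (Y' i \<omega> = v i)) \<partial>N :: real)"
proof -
  note [measurable] = M(2) N(2)
  have "(\<lambda>n. \<integral>\<omega>. (\<Prod>i\<in>J. of_bool (Y n i \<omega> = v i)) * (\<Prod>i\<in>I-J. s i ^ Y n i \<omega>) \<partial>M)
      \<longlonglongrightarrow> (\<integral>\<omega>. (\<Prod>i\<in>J. of_bool (Y' i \<omega> = v i)) * (\<Prod>i\<in>I-J. s i ^ Y' i \<omega>) \<partial>N)"
    if "finite J" "J \<subseteq> I" "\<And>i. i \<in> I \<Longrightarrow> 0 < s i \<and> s i < 1" for J and s :: "'i \<Rightarrow> real"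
    using that
  proof (induction J arbitrary: s)
    case empty
    then show ?case using pgf[of s] by simp
  next
    case (insert j J)
    define G where "G y = (\<Prod>i\<in>J. of_bool (y i = v i)) * (\<Prod>i\<in>I - insert j J. s i ^ y i)" for y :: "'i \<Rightarrow> nat"
    have G01: "0 \<le> G y" "G y \<le> 1" for y
    proof -
      have A: "0 \<le> (\<Prod>i\<in>J. of_bool (y i = v i) :: real)" "(\<Prod>i\<in>J. of_bool (y i = v i) :: real) \<le> 1"
        by (auto intro!: prod_nonneg prod_le_1)
      have B: "0 \<le> (\<Prod>i\<in>I - insert j J. s i ^ y i)" "(\<Prod>i\<in>I - insert j J. s i ^ y i) \<le> 1"
        using insert(5) by (auto intro!: prod_nonneg prod_le_1 power_le_one simp: less_imp_le)
      show "0 \<le> G y" "G y \<le> 1"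
        using A B unfolding G_def by (auto intro!: mult_le_one)
    qed
    \<comment> \<open>The induction hypothesis is used with the exponent base \<open>t\<close> at the coordinate \<open>j\<close>, for every \<open>t\<close>.\<close>
    have I': "I - J = insert j (I - insert j J)"
      using insert by auto
    have "(\<lambda>n. \<integral>\<omega>. G (\<lambda>i. Y n i \<omega>) * of_bool (Y n j \<omega> = v j) \<partial>M)
        \<longlonglongrightarrow> (\<integral>\<omega>. G (\<lambda>i. Y' i \<omega>) * of_bool (Y' j \<omega> = v j) \<partial>N)"
    proof (rule tendsto_atom_of_pgf[OF M(1) _ _ _ _ N(1)])
      fix t :: real assume t: "0 < t" "t < 1"
      have "(\<Prod>i\<in>J. of_bool (y i = v i)) * (\<Prod>i\<in>I-J. (s(j := t)) i ^ y i) = G y * t ^ y j" for y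
      proof -
        have "(\<Prod>i\<in>I - insert j J. (s(j := t)) i ^ y i) = (\<Prod>i\<in>I - insert j J. s i ^ y i)"
          by (intro prod.cong) auto
        then show ?thesis
          using I unfolding I' by (subst prod.insert) (auto simp: G_def)
      qed
      then show "(\<lambda>n. \<integral>\<omega>. G (\<lambda>i. Y n i \<omega>) * t ^ Y n j \<omega> \<partial>M) \<longlonglongrightarrow> (\<integral>\<omega>. G (\<lambda>i. Y' i \<omega>) * t ^ Y' j \<omega> \<partial>N)"
        using insert(3)[of "s(j := t)"] insert(4,5) t by simp
    next
      show "(\<lambda>\<omega>. G (\<lambda>i. Y n i \<omega>)) \<in> borel_measurable M" for n
        unfolding G_def using insert(4) by (intro borel_measurable_times borel_measurable_prod) auto
      show "(\<lambda>\<omega>. G (\<lambda>i. Y' i \<omega>)) \<in> borel_measurable N"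
        unfolding G_def using insert(4) by (intro borel_measurable_times borel_measurable_prod) auto
    qed (use insert(4) M N G01 in auto)
    moreover have "(\<Prod>i\<in>insert j J. of_bool (y i = v i)) * (\<Prod>i\<in>I - insert j J. s i ^ y i) = G y * of_bool (y j = v j)" for y
      using insert(1,2) by (simp add: G_def)
    ultimately show ?case
      by simp
  qed
  from this[of I "\<lambda>_. 1/2"] I show ?thesis
    by simp
qed

text \<open>
  Scheffe's argument: a finite set of values carries almost all mass of the limit law, hence, by
  convergence of the atoms, also of the approximating laws, so the values outside it contribute
  little to a bounded \<open>g\<close>.
\<close>

lemma tendsto_expectation_of_atoms:
  fixes T :: "nat \<Rightarrow> 'a \<Rightarrow> 'v" and T' :: "'b \<Rightarrow> 'v" and g :: "'v \<Rightarrow> real"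
  assumes M: "prob_space M" "\<And>n. T n \<in> M \<rightarrow>\<^sub>M count_space S"
    and N: "prob_space N" "T' \<in> N \<rightarrow>\<^sub>M count_space S"
    and S: "countable S"
    and atoms: "\<And>v. v \<in> S \<Longrightarrow> (\<lambda>n. \<integral>\<omega>. of_bool (T n \<omega> = v) \<partial>M) \<longlonglongrightarrow> (\<integral>\<omega>. of_bool (T' \<omega> = v) \<partial>N :: real)"
    and g: "\<And>v. v \<in> S \<Longrightarrow> \<bar>g v\<bar> \<le> B"
  shows "(\<lambda>n. \<integral>\<omega>. g (T n \<omega>) \<partial>M) \<longlonglongrightarrow> (\<integral>\<omega>. g (T' \<omega>) \<partial>N)"
proof (rule LIMSEQ_I)
  fix e :: real assume e: "0 < e"
  \<comment> \<open>The values outside \<open>V\<close> contribute at most \<open>B\<close> times their probability.\<close>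
  have err: "\<bar>(\<integral>\<omega>. g (R \<omega>) \<partial>Q) - (\<Sum>v\<in>V. g v * (\<integral>\<omega>. of_bool (R \<omega> = v) \<partial>Q))\<bar>
       \<le> B * (1 - (\<Sum>v\<in>V. \<integral>\<omega>. of_bool (R \<omega> = v) \<partial>Q))"
    if Q: "prob_space Q" and R[measurable]: "R \<in> Q \<rightarrow>\<^sub>M count_space S" and V: "finite V" "V \<subseteq> S"
    for Q :: "'c measure" and R V
  proof -
    interpret Q: prob_space Q by fact
    have RS: "R \<omega> \<in> S" if "\<omega> \<in> space Q" for \<omega>
      using measurable_space[OF R that] by simp
    have pred[measurable]: "Measurable.pred Q (\<lambda>\<omega>. R \<omega> = v)" for v
    proof -
      have "R -` (S \<inter> {v}) \<inter> space Q \<in> sets Q"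
        using R by (rule measurable_sets) simp
      also have "R -` (S \<inter> {v}) \<inter> space Q = {\<omega>\<in>space Q. R \<omega> = v}"
        using RS by auto
      finally show ?thesis by (simp add: pred_def)
    qed
    have gm[measurable]: "(\<lambda>\<omega>. g (R \<omega>)) \<in> borel_measurable Q"
      by (rule measurable_compose[OF R]) (simp add: measurable_count_space_eq1)
    have i1: "integrable Q (\<lambda>\<omega>. g (R \<omega>))"
      using g RS by (intro Q.integrable_const_bound[where B=B]) auto
    have i2: "integrable Q (\<lambda>\<omega>. of_bool (R \<omega> = v) :: real)" for v
      by (intro Q.integrable_const_bound[where B=1]) auto
    have i3: "integrable Q (\<lambda>\<omega>. \<Sum>v\<in>V. a v * of_bool (R \<omega> = v))" for a :: "'v \<Rightarrow> real"
      using i2 by auto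
    have e3: "(\<integral>\<omega>. (\<Sum>v\<in>V. a v * of_bool (R \<omega> = v)) \<partial>Q) = (\<Sum>v\<in>V. a v * (\<integral>\<omega>. of_bool (R \<omega> = v) \<partial>Q))" for a :: "'v \<Rightarrow> real"
      using i2 by (subst Bochner_Integration.integral_sum) auto
    have bd: "\<bar>g (R \<omega>) - (\<Sum>v\<in>V. g v * of_bool (R \<omega> = v))\<bar> \<le> B - (\<Sum>v\<in>V. B * of_bool (R \<omega> = v))"
      if "\<omega> \<in> space Q" for \<omega>
    proof -
      have "(\<Sum>v\<in>V. a v * of_bool (R \<omega> = v)) = (if R \<omega> \<in> V then a (R \<omega>) else 0)" for a :: "'v \<Rightarrow> real"
      proof -
        have "(\<Sum>v\<in>V. a v * of_bool (R \<omega> = v)) = (\<Sum>v\<in>V. if R \<omega> = v then a v else 0)"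
          by (intro sum.cong) auto
        then show ?thesis using V by (simp add: sum.delta)
      qed
      then show ?thesis
        using g[OF RS[OF that]] by simp
    qed
    have "\<bar>(\<integral>\<omega>. g (R \<omega>) \<partial>Q) - (\<Sum>v\<in>V. g v * (\<integral>\<omega>. of_bool (R \<omega> = v) \<partial>Q))\<bar>
        = \<bar>\<integral>\<omega>. g (R \<omega>) - (\<Sum>v\<in>V. g v * of_bool (R \<omega> = v)) \<partial>Q\<bar>"
      using Bochner_Integration.integral_diff[OF i1 i3[of g]] e3[of g] by simp
    also have "\<dots> \<le> (\<integral>\<omega>. B - (\<Sum>v\<in>V. B * of_bool (R \<omega> = v)) \<partial>Q)"
      using i1 i3[of g] i3[of "\<lambda>_. B"] bd
      by (intro order_trans[OF integral_abs_bound] integral_mono integrable_abs Bochner_Integration.integrable_diff) auto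
    also have "\<dots> = B * (1 - (\<Sum>v\<in>V. \<integral>\<omega>. of_bool (R \<omega> = v) \<partial>Q))"
      using Bochner_Integration.integral_diff[OF _ i3[of "\<lambda>_. B"], of "\<lambda>_. B"] e3[of "\<lambda>_. B"]
      by (simp add: Q.prob_space sum_distrib_left right_diff_distrib)
    finally show ?thesis .
  qed
  interpret N: prob_space N by fact
  have TS: "T' \<omega> \<in> S" if "\<omega> \<in> space N" for \<omega>
    using measurable_space[OF N(2) that] by simp
  obtain \<omega>0 where "\<omega>0 \<in> space N"
    using N.not_empty by blast
  then have "S \<noteq> {}" and B: "0 \<le> B"
    using TS g[of "T' \<omega>0"] by auto
  let ?V = "\<lambda>k. from_nat_into S ` {..k::nat}"
  have VS: "?V k \<subseteq> S" for k
    using from_nat_into[OF \<open>S \<noteq> {}\<close>] by auto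
  have meas: "T' -` V \<inter> space N \<in> sets N" if "V \<subseteq> S" for V
    using that by (intro measurable_sets[OF N(2)]) simp
  have sumV: "(\<Sum>v\<in>?V k. \<integral>\<omega>. of_bool (T' \<omega> = v) \<partial>N :: real) = measure N (T' -` ?V k \<inter> space N)" for k
  proof -
    have "(\<integral>\<omega>. of_bool (T' \<omega> = v) \<partial>N :: real) = measure N (T' -` {v} \<inter> space N)" if "v \<in> S" for v
    proof -
      have "(\<integral>\<omega>. of_bool (T' \<omega> = v) \<partial>N :: real) = (\<integral>\<omega>. indicator (T' -` {v} \<inter> space N) \<omega> \<partial>N)"
        by (intro Bochner_Integration.integral_cong) (auto simp: indicator_def)
      also have "\<dots> = measure N (T' -` {v} \<inter> space N)"
        using meas[of "{v}"] that by simp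
      finally show ?thesis .
    qed
    then have "(\<Sum>v\<in>?V k. \<integral>\<omega>. of_bool (T' \<omega> = v) \<partial>N :: real) = (\<Sum>v\<in>?V k. measure N (T' -` {v} \<inter> space N))"
      using VS by (intro sum.cong) auto
    also have "\<dots> = measure N (\<Union>v\<in>?V k. T' -` {v} \<inter> space N)"
    proof (rule N.finite_measure_finite_Union[symmetric])
      show "(\<lambda>v. T' -` {v} \<inter> space N) ` ?V k \<subseteq> sets N"
        using VS[of k] by (intro image_subsetI meas) blast
    qed (auto simp: disjoint_family_on_def)
    also have "(\<Union>v\<in>?V k. T' -` {v} \<inter> space N) = T' -` ?V k \<inter> space N"
      by auto
    finally show ?thesis .
  qed
  have "(\<lambda>k. measure N (T' -` ?V k \<inter> space N)) \<longlonglongrightarrow> measure N (\<Union>k. T' -` ?V k \<inter> space N)"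
    using meas VS by (intro N.finite_Lim_measure_incseq) (auto simp: incseq_def)
  moreover have "(\<Union>k. T' -` ?V k \<inter> space N) = space N"
  proof
    show "space N \<subseteq> (\<Union>k. T' -` ?V k \<inter> space N)"
    proof
      fix \<omega> assume \<omega>: "\<omega> \<in> space N"
      obtain k where "from_nat_into S k = T' \<omega>"
        using from_nat_into_surj[OF S TS[OF \<omega>]] by blast
      then have "T' \<omega> \<in> ?V k"
        by force
      with \<omega> show "\<omega> \<in> (\<Union>k. T' -` ?V k \<inter> space N)"
        by blast
    qed
  qed blast
  ultimately have "(\<lambda>k. measure N (T' -` ?V k \<inter> space N)) \<longlonglongrightarrow> 1"
    by (simp add: N.prob_space)
  then have "eventually (\<lambda>k. 1 - e / (2 * B + 2) < measure N (T' -` ?V k \<inter> space N)) sequentially"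
    using e B by (intro order_tendstoD) auto
  then obtain k where k: "1 - e / (2 * B + 2) < measure N (T' -` ?V k \<inter> space N)"
    unfolding eventually_sequentially by blast
  define V where "V = ?V k"
  have V: "finite V" "V \<subseteq> S"
    using VS by (auto simp: V_def)
  let ?p = "\<lambda>n v. \<integral>\<omega>. of_bool (T n \<omega> = v) \<partial>M :: real" and ?p' = "\<lambda>v. \<integral>\<omega>. of_bool (T' \<omega> = v) \<partial>N :: real"
  let ?d = "\<lambda>n. \<bar>(\<Sum>v\<in>V. g v * ?p n v) - (\<Sum>v\<in>V. g v * ?p' v)\<bar>
      + B * (1 - (\<Sum>v\<in>V. ?p n v)) + B * (1 - (\<Sum>v\<in>V. ?p' v))"
  have "?d \<longlonglongrightarrow> \<bar>(\<Sum>v\<in>V. g v * ?p' v) - (\<Sum>v\<in>V. g v * ?p' v)\<bar>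
      + B * (1 - (\<Sum>v\<in>V. ?p' v)) + B * (1 - (\<Sum>v\<in>V. ?p' v))"
    using V by (intro tendsto_intros atoms) auto
  moreover have "\<bar>(\<Sum>v\<in>V. g v * ?p' v) - (\<Sum>v\<in>V. g v * ?p' v)\<bar>
      + B * (1 - (\<Sum>v\<in>V. ?p' v)) + B * (1 - (\<Sum>v\<in>V. ?p' v)) < e"
  proof -
    have "(2 * B) * (1 - (\<Sum>v\<in>V. ?p' v)) \<le> (2 * B) * (e / (2 * B + 2))"
      using k B sumV unfolding V_def by (intro mult_left_mono) auto
    also have "\<dots> < e"
      using e B by (simp add: field_simps)
    finally show ?thesis by simp
  qed
  ultimately have "eventually (\<lambda>n. ?d n < e) sequentially"
    by (rule order_tendstoD)
  then obtain n0 where n0: "\<And>n. n \<ge> n0 \<Longrightarrow> ?d n < e"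
    by (auto simp: eventually_sequentially)
  have tri: "\<bar>a - b\<bar> < e" if "\<bar>a - x\<bar> \<le> p" "\<bar>b - y\<bar> \<le> q" "\<bar>x - y\<bar> + p + q < e" for a b x y p q :: real
    using that by linarith
  have "norm ((\<integral>\<omega>. g (T n \<omega>) \<partial>M) - (\<integral>\<omega>. g (T' \<omega>) \<partial>N)) < e" if "n \<ge> n0" for n
    unfolding real_norm_def by (rule tri[OF err[OF M V] err[OF N V] n0[OF that]])
  then show "\<exists>no. \<forall>n\<ge>no. norm ((\<integral>\<omega>. g (T n \<omega>) \<partial>M) - (\<integral>\<omega>. g (T' \<omega>) \<partial>N)) < e"
    by blast
qed

lemma measurable_restrict_count_space:
  fixes Y :: "'i \<Rightarrow> 'a \<Rightarrow> nat"
  assumes I: "finite I" and Y[measurable]: "\<And>i. i \<in> I \<Longrightarrow> Y i \<in> M \<rightarrow>\<^sub>M count_space UNIV"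
  shows "(\<lambda>\<omega>. \<lambda>i\<in>I. Y i \<omega>) \<in> M \<rightarrow>\<^sub>M count_space (I \<rightarrow>\<^sub>E UNIV)"
proof -
  have "(\<lambda>\<omega>. \<lambda>i\<in>I. Y i \<omega>) -` {v} \<inter> space M \<in> sets M" if "v \<in> I \<rightarrow>\<^sub>E UNIV" for v
  proof -
    have "(\<lambda>\<omega>. \<lambda>i\<in>I. Y i \<omega>) -` {v} \<inter> space M = {\<omega>\<in>space M. \<forall>i\<in>I. Y i \<omega> = v i}"
      using that by (auto simp: fun_eq_iff PiE_iff extensional_def)
    also have "\<dots> \<in> sets M"
      using I by measurable
    finally show ?thesis .
  qed
  moreover have "countable (I \<rightarrow>\<^sub>E (UNIV :: nat set))"
    using I by (intro countable_PiE) auto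
  ultimately show ?thesis
    by (subst measurable_count_space_eq_countable) auto
qed

lemma tendsto_expectation_of_pgf:
  fixes Y :: "nat \<Rightarrow> 'i \<Rightarrow> 'a \<Rightarrow> nat" and Y' :: "'i \<Rightarrow> 'b \<Rightarrow> nat" and g :: "('i \<Rightarrow> nat) \<Rightarrow> real"
  assumes M: "prob_space M" "\<And>n i. i \<in> I \<Longrightarrow> Y n i \<in> M \<rightarrow>\<^sub>M count_space UNIV"
    and N: "prob_space N" "\<And>i. i \<in> I \<Longrightarrow> Y' i \<in> N \<rightarrow>\<^sub>M count_space UNIV"
    and I: "finite I"
    and pgf: "\<And>s :: 'i \<Rightarrow> real. (\<And>i. i \<in> I \<Longrightarrow> 0 < s i \<and> s i < 1) \<Longrightarrow>
      (\<lambda>n. \<integral>\<omega>. (\<Prod>i\<in>I. s i ^ Y n i \<omega>) \<partial>M) \<longlonglongrightarrow> (\<integral>\<omega>. (\<Prod>i\<in>I. s i ^ Y' i \<omega>) \<partial>N)"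
    and g: "\<And>v. \<bar>g v\<bar> \<le> B"
  shows "(\<lambda>n. \<integral>\<omega>. g (\<lambda>i\<in>I. Y n i \<omega>) \<partial>M) \<longlonglongrightarrow> (\<integral>\<omega>. g (\<lambda>i\<in>I. Y' i \<omega>) \<partial>N :: real)"
proof (rule tendsto_expectation_of_atoms[where T="\<lambda>n \<omega>. \<lambda>i\<in>I. Y n i \<omega>" and T'="\<lambda>\<omega>. \<lambda>i\<in>I. Y' i \<omega>", OF M(1) _ N(1)])
  show "countable (I \<rightarrow>\<^sub>E (UNIV :: nat set))"
    using I by (intro countable_PiE) auto
  fix v :: "'i \<Rightarrow> nat" assume v: "v \<in> I \<rightarrow>\<^sub>E UNIV"
  have "(\<lambda>i\<in>I. y i) = v \<longleftrightarrow> (\<forall>i\<in>I. y i = v i)" for y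
    using v by (auto simp: fun_eq_iff PiE_iff extensional_def)
  then have "of_bool ((\<lambda>i\<in>I. y i) = v) = (\<Prod>i\<in>I. of_bool (y i = v i) :: real)" for y
    using I by (auto simp: of_bool_def prod_zero_iff)
  then show "(\<lambda>n. \<integral>\<omega>. of_bool ((\<lambda>i\<in>I. Y n i \<omega>) = v) \<partial>M) \<longlonglongrightarrow> (\<integral>\<omega>. of_bool ((\<lambda>i\<in>I. Y' i \<omega>) = v) \<partial>N :: real)"
    using tendsto_joint_atom_of_pgf[OF M N I pgf, of v] by simp
qed (rule measurable_restrict_count_space[OF I M(2)] measurable_restrict_count_space[OF I N(2)] g; assumption?)+

section \<open>Squeezing continuous functionals between functions of counts\<close>

definition counts :: "real \<Rightarrow> nat \<Rightarrow> (unit_ivl \<times> rplus) measure \<Rightarrow> nat \<times> nat \<Rightarrow> nat" where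
  "counts \<theta> m \<xi> = (\<lambda>k\<in>grid m. cnt \<xi> (cell \<theta> m k))"

text \<open>
  Inserting \<open>- B\<close>, a lower bound of \<open>F\<close>, keeps the supremum bounded also for vectors \<open>v\<close> that are
  not the counts of any point measure.
\<close>

definition upper_envelope ::
  "((unit_ivl \<times> rplus) measure \<Rightarrow> real) \<Rightarrow> real \<Rightarrow> real \<Rightarrow> nat \<Rightarrow> (nat \<times> nat \<Rightarrow> nat) \<Rightarrow> real" where
  "upper_envelope F B \<theta> m v = Sup (insert (- B) (F ` {\<eta> \<in> point_measures. counts \<theta> m \<eta> = v}))"

lemma upper_envelope_abs_le:
  assumes "\<And>\<xi>. \<xi> \<in> point_measures \<Longrightarrow> \<bar>F \<xi>\<bar> \<le> B" "0 \<le> B"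
  shows "\<bar>upper_envelope F B \<theta> m v\<bar> \<le> B"
proof -
  have "upper_envelope F B \<theta> m v \<le> B"
    unfolding upper_envelope_def using assms by (intro cSup_least) (auto dest: abs_le_D1)
  moreover have "- B \<le> upper_envelope F B \<theta> m v"
    unfolding upper_envelope_def using assms
    by (intro cSup_upper) (auto intro!: bdd_aboveI[of _ B] dest: abs_le_D1)
  ultimately show ?thesis by simp
qed

lemma upper_envelope_ge:
  assumes "\<And>\<xi>. \<xi> \<in> point_measures \<Longrightarrow> \<bar>F \<xi>\<bar> \<le> B" "0 \<le> B" "\<xi> \<in> point_measures"
  shows "F \<xi> \<le> upper_envelope F B \<theta> m (counts \<theta> m \<xi>)"
  unfolding upper_envelope_def using assms
  by (intro cSup_upper) (auto intro!: bdd_aboveI[of _ B] dest: abs_le_D1)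

text \<open>
  Pick at each level a point measure with the counts of \<open>\<xi>\<close> that almost attains the supremum. These
  point measures converge vaguely to \<open>\<xi>\<close>, so their values under \<open>F\<close> converge to \<open>F \<xi>\<close>.
\<close>

lemma upper_envelope_tendsto:
  assumes F: "continuous_map vague_topology euclideanreal F"
    and B: "\<And>\<xi>. \<xi> \<in> point_measures \<Longrightarrow> \<bar>F \<xi>\<bar> \<le> B" "0 \<le> B"
    and \<xi>: "\<xi> \<in> point_measures" and \<theta>: "0 \<le> \<theta>" "\<theta> < 1"
  shows "(\<lambda>m. upper_envelope F B \<theta> m (counts \<theta> m \<xi>)) \<longlonglongrightarrow> F \<xi>"
proof -
  let ?U = "\<lambda>m. upper_envelope F B \<theta> m (counts \<theta> m \<xi>)"
  have "\<exists>\<eta>. \<eta> \<in> point_measures \<and> counts \<theta> m \<eta> = counts \<theta> m \<xi> \<and> ?U m - 1 / Suc m \<le> F \<eta>" for m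
  proof -
    have "?U m - 1 / Suc m < ?U m"
      by simp
    then obtain y where y: "y \<in> insert (- B) (F ` {\<eta> \<in> point_measures. counts \<theta> m \<eta> = counts \<theta> m \<xi>})"
        "?U m - 1 / Suc m < y"
      unfolding upper_envelope_def[of F B \<theta> m] by (rule less_cSupE) auto
    show ?thesis
    proof (cases "y = - B")
      case True
      then have "?U m - 1 / Suc m \<le> F \<xi>"
        using y(2) B(1)[OF \<xi>] by (simp add: abs_le_iff)
      with \<xi> show ?thesis by blast
    qed (use y in auto)
  qed
  then obtain \<eta> where \<eta>: "\<And>m. \<eta> m \<in> point_measures" "\<And>m. counts \<theta> m (\<eta> m) = counts \<theta> m \<xi>"
      "\<And>m. ?U m - 1 / Suc m \<le> F (\<eta> m)"
    by metis
  have same: "cnt (\<eta> m) (cell \<theta> m k) = cnt \<xi> (cell \<theta> m k)" if "k \<in> grid m" for m k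
    using fun_cong[OF \<eta>(2)[of m], of k] that by (simp add: counts_def)
  have "limitin vague_topology \<eta> \<xi> sequentially"
    using integral_tendsto_of_same_counts[OF _ \<theta> \<xi> \<eta>(1) same] by (intro limitin_vague \<xi> \<eta>(1))
  then have "limitin euclideanreal (F \<circ> \<eta>) (F \<xi>) sequentially"
    by (rule continuous_map_limit[OF F])
  then have lim: "(\<lambda>m. F (\<eta> m) + 1 / Suc m) \<longlonglongrightarrow> F \<xi> + 0"
    by (intro tendsto_add LIMSEQ_Suc[OF lim_1_over_n]) (simp add: o_def)
  show ?thesis
  proof (rule tendsto_sandwich[OF _ _ tendsto_const])
    show "\<forall>\<^sub>F m in sequentially. F \<xi> \<le> ?U m"
      using upper_envelope_ge[of F B \<xi>, OF B \<xi>] by simp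
    show "\<forall>\<^sub>F m in sequentially. ?U m \<le> F (\<eta> m) + 1 / Suc m"
      using \<eta>(3) by (auto simp: algebra_simps)
  qed (use lim in simp)
qed

lemma space_borel_of [simp]: "space (borel_of T) = topspace T"
  unfolding borel_of_def by (rule space_measure_of) (auto dest: openin_subset)

lemma sets_borel_of: "openin T U \<Longrightarrow> U \<in> sets (borel_of T)"
  unfolding borel_of_def by (subst sets_measure_of) (auto dest: openin_subset)

lemma borel_measurable_continuous_map:
  assumes "continuous_map T euclideanreal F"
  shows "F \<in> borel_measurable (borel_of T)"
proof (rule borel_measurableI)
  fix S :: "real set" assume "open S"
  then have "openin T {x \<in> topspace T. F x \<in> S}"
    using assms by (intro openin_continuous_map_preimage[OF assms]) auto
  moreover have "F -` S \<inter> space (borel_of T) = {x \<in> topspace T. F x \<in> S}"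
    by auto
  ultimately show "F -` S \<inter> space (borel_of T) \<in> sets (borel_of T)"
    by (simp add: sets_borel_of)
qed

text \<open>
  For fixed \<open>m\<close> the expectation of the envelope converges with \<open>n\<close>, because it is a bounded function of
  a count vector. Afterwards \<open>m\<close> tends to infinity, and this limit concerns the law of \<open>Z'\<close> alone: the
  inequality between \<open>F\<close> and its envelope holds for every \<open>n\<close> and \<open>m\<close>, so the two limits are never interchanged.
\<close>

lemma conv_in_distr_of_counts:
  fixes M :: "'a measure" and N :: "'b measure"
  assumes M: "prob_space M" and N: "prob_space N" and \<theta>: "0 \<le> \<theta>" "\<theta> < 1"
    and Z: "\<And>n. Z n \<in> M \<rightarrow>\<^sub>M borel_of vague_topology" "Z' \<in> N \<rightarrow>\<^sub>M borel_of vague_topology"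
    and cM: "\<And>n m k. k \<in> grid m \<Longrightarrow> (\<lambda>\<omega>. cnt (Z n \<omega>) (cell \<theta> m k)) \<in> M \<rightarrow>\<^sub>M count_space UNIV"
    and cN: "\<And>m k. k \<in> grid m \<Longrightarrow> (\<lambda>\<omega>. cnt (Z' \<omega>) (cell \<theta> m k)) \<in> N \<rightarrow>\<^sub>M count_space UNIV"
    and pgf: "\<And>m s :: nat \<times> nat \<Rightarrow> real. (\<And>k. k \<in> grid m \<Longrightarrow> 0 < s k \<and> s k < 1) \<Longrightarrow>
      (\<lambda>n. \<integral>\<omega>. (\<Prod>k\<in>grid m. s k ^ cnt (Z n \<omega>) (cell \<theta> m k)) \<partial>M)
        \<longlonglongrightarrow> (\<integral>\<omega>. (\<Prod>k\<in>grid m. s k ^ cnt (Z' \<omega>) (cell \<theta> m k)) \<partial>N)"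
  shows "conv_in_distr vague_topology M Z N Z'"
proof -
  interpret M: prob_space M by fact
  interpret N: prob_space N by fact
  have ZM: "Z n \<omega> \<in> point_measures" if "\<omega> \<in> space M" for n \<omega>
    using measurable_space[OF Z(1) that, of n] by simp
  have ZN: "Z' \<omega> \<in> point_measures" if "\<omega> \<in> space N" for \<omega>
    using measurable_space[OF Z(2) that] by simp
  \<comment> \<open>The envelope bounds \<open>F\<close> from above only; the lower bound comes from \<open>- F\<close>.\<close>
  have upper: "eventually (\<lambda>n. (\<integral>\<omega>. F (Z n \<omega>) \<partial>M) < (\<integral>\<omega>. F (Z' \<omega>) \<partial>N) + e) sequentially"
    if F: "continuous_map vague_topology euclideanreal F"
      and B: "\<And>\<xi>. \<xi> \<in> point_measures \<Longrightarrow> \<bar>F \<xi>\<bar> \<le> B" "0 \<le> B" and e: "0 < e" for F B e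
  proof -
    let ?U = "upper_envelope F B \<theta>"
    note U = upper_envelope_abs_le[of F B, OF B]
    have FM[measurable]: "(\<lambda>\<omega>. F (Z n \<omega>)) \<in> borel_measurable M" for n
      by (rule measurable_compose[OF Z(1) borel_measurable_continuous_map[OF F]])
    have FN[measurable]: "(\<lambda>\<omega>. F (Z' \<omega>)) \<in> borel_measurable N"
      by (rule measurable_compose[OF Z(2) borel_measurable_continuous_map[OF F]])
    have UM[measurable]: "(\<lambda>\<omega>. ?U m (counts \<theta> m (Z n \<omega>))) \<in> borel_measurable M" for m n
      unfolding counts_def
      by (rule measurable_compose[OF measurable_restrict_count_space[OF finite_grid cM]])
        (simp_all add: measurable_count_space_eq1)
    have UN[measurable]: "(\<lambda>\<omega>. ?U m (counts \<theta> m (Z' \<omega>))) \<in> borel_measurable N" for m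
      unfolding counts_def
      by (rule measurable_compose[OF measurable_restrict_count_space[OF finite_grid cN]])
        (simp_all add: measurable_count_space_eq1)
    have "(\<lambda>m. \<integral>\<omega>. ?U m (counts \<theta> m (Z' \<omega>)) \<partial>N) \<longlonglongrightarrow> (\<integral>\<omega>. F (Z' \<omega>) \<partial>N)"
    proof (rule integral_dominated_convergence[where w="\<lambda>_. B"])
      show "AE \<omega> in N. (\<lambda>m. ?U m (counts \<theta> m (Z' \<omega>))) \<longlonglongrightarrow> F (Z' \<omega>)"
        using ZN by (intro AE_I2 upper_envelope_tendsto[OF F B _ \<theta>])
    qed (use U in auto)
    then obtain m where m: "(\<integral>\<omega>. ?U m (counts \<theta> m (Z' \<omega>)) \<partial>N) < (\<integral>\<omega>. F (Z' \<omega>) \<partial>N) + e"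
      using order_tendstoD(2)[of _ "\<integral>\<omega>. F (Z' \<omega>) \<partial>N" sequentially "(\<integral>\<omega>. F (Z' \<omega>) \<partial>N) + e"] e
      unfolding eventually_sequentially by (meson less_add_same_cancel1 order_refl)
    have "(\<lambda>n. \<integral>\<omega>. ?U m (counts \<theta> m (Z n \<omega>)) \<partial>M) \<longlonglongrightarrow> (\<integral>\<omega>. ?U m (counts \<theta> m (Z' \<omega>)) \<partial>N)"
      unfolding counts_def
      by (rule tendsto_expectation_of_pgf[where B=B and Y="\<lambda>n k \<omega>. cnt (Z n \<omega>) (cell \<theta> m k)"
            and Y'="\<lambda>k \<omega>. cnt (Z' \<omega>) (cell \<theta> m k)", OF M cM N cN finite_grid pgf U])
    then have "eventually (\<lambda>n. (\<integral>\<omega>. ?U m (counts \<theta> m (Z n \<omega>)) \<partial>M) < (\<integral>\<omega>. F (Z' \<omega>) \<partial>N) + e) sequentially"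
      using m by (rule order_tendstoD)
    moreover have "(\<integral>\<omega>. F (Z n \<omega>) \<partial>M) \<le> (\<integral>\<omega>. ?U m (counts \<theta> m (Z n \<omega>)) \<partial>M)" for n
    proof (rule integral_mono)
      show "integrable M (\<lambda>\<omega>. F (Z n \<omega>))"
        using B(1) ZM by (intro M.integrable_const_bound[where B=B]) auto
      show "integrable M (\<lambda>\<omega>. ?U m (counts \<theta> m (Z n \<omega>)))"
        using U by (intro M.integrable_const_bound[where B=B]) auto
      show "F (Z n \<omega>) \<le> ?U m (counts \<theta> m (Z n \<omega>))" if "\<omega> \<in> space M" for \<omega>
        by (rule upper_envelope_ge[of F B, OF B ZM[OF that]])
    qed
    ultimately show ?thesis
      by (auto elim!: eventually_mono intro: le_less_trans)
  qed
  have "(\<lambda>n. \<integral>\<omega>. F (Z n \<omega>) \<partial>M) \<longlonglongrightarrow> (\<integral>\<omega>. F (Z' \<omega>) \<partial>N)"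
    if F: "continuous_map vague_topology euclideanreal F" and bF: "bounded (F ` topspace vague_topology)" for F
  proof -
    obtain B where B: "0 < B" "\<And>\<xi>. \<xi> \<in> point_measures \<Longrightarrow> \<bar>F \<xi>\<bar> \<le> B"
      using bF unfolding bounded_pos by auto
    have F': "continuous_map vague_topology euclideanreal (\<lambda>\<xi>. - F \<xi>)"
      using F by (rule continuous_map_minus)
    show ?thesis
    proof (rule order_tendstoI)
      fix a assume a: "a < (\<integral>\<omega>. F (Z' \<omega>) \<partial>N)"
      from upper[OF F', of B "(\<integral>\<omega>. F (Z' \<omega>) \<partial>N) - a"] B a
      show "eventually (\<lambda>n. a < (\<integral>\<omega>. F (Z n \<omega>) \<partial>M)) sequentially"
        by simp
    next
      fix a assume a: "(\<integral>\<omega>. F (Z' \<omega>) \<partial>N) < a"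
      from upper[OF F, of B "a - (\<integral>\<omega>. F (Z' \<omega>) \<partial>N)"] B a
      show "eventually (\<lambda>n. (\<integral>\<omega>. F (Z n \<omega>) \<partial>M) < a) sequentially"
        by simp
    qed
  qed
  then show ?thesis
    using Z by (simp add: conv_in_distr_def)
qed

lemma Rep_rplus_of_real: "0 < x \<Longrightarrow> Rep_rplus (rplus_of_real x) = ereal x"
  by (simp add: rplus_of_real_def Abs_rplus_inverse)

lemma recip_rplus_of_real: "0 < x \<Longrightarrow> recip (rplus_of_real x) = 1 / x"
  by (simp add: recip_def Rep_rplus_of_real one_ereal_def)

lemma continuous_on_rplus_of_real: "continuous_on {0<..} rplus_of_real"
proof -
  have "dist (rplus_of_real x) (rplus_of_real y) = dist (1 / x) (1 / y)" if "0 < x" "0 < y" for x y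
    unfolding dist_recip[symmetric] using that by (simp add: recip_rplus_of_real)
  moreover have "continuous_on {0<..} (\<lambda>x::real. 1 / x)"
    by (intro continuous_intros) auto
  ultimately show ?thesis
    unfolding continuous_on_iff by fastforce
qed

section \<open>Measurability of the row processes\<close>

text \<open>
  A test function vanishes near the missing point \<open>0\<close>, so it extends by zero to the whole line.
\<close>

lemma continuous_extend_CK_plus:
  assumes f: "f \<in> (CK_plus :: (unit_ivl \<times> rplus \<Rightarrow> real) set)"
  shows "continuous_on UNIV (\<lambda>y::real. if 0 < y then f (u, rplus_of_real y) else 0)"
proof -
  obtain r where r: "0 < r" "\<And>z. f z \<noteq> 0 \<Longrightarrow> recip (snd z) \<le> r"
    using CK_plus_vanishes[OF f] by blast
  have "continuous_on ({0<..} \<union> {..<1/r}) (\<lambda>y::real. if 0 < y then f (u, rplus_of_real y) else 0)"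
  proof (rule continuous_on_open_Un)
    have "continuous_on {0<..} (\<lambda>y. f (u, rplus_of_real y))"
    proof (rule continuous_on_compose2[where g=f and t=UNIV])
      show "continuous_on UNIV f"
        using f by (simp add: CK_plus_def)
      show "continuous_on {0<..} (\<lambda>y. (u, rplus_of_real y))"
        by (rule continuous_on_Pair[OF continuous_on_const continuous_on_rplus_of_real])
    qed simp
    then show "continuous_on {0<..} (\<lambda>y::real. if 0 < y then f (u, rplus_of_real y) else 0)"
      by (rule continuous_on_eq) auto
    have "0 = (if 0 < y then f (u, rplus_of_real y) else 0)" if "y \<in> {..<1/r}" for y
    proof (cases "0 < y")
      case True
      then have "r < 1 / y"
        using that r(1) by (simp add: field_simps)
      with True show ?thesis
        using r(2)[of "(u, rplus_of_real y)"] by (auto simp: recip_rplus_of_real)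
    qed simp
    then show "continuous_on {..<1/r} (\<lambda>y::real. if 0 < y then f (u, rplus_of_real y) else 0)"
      by (rule continuous_on_eq[OF continuous_on_const])
  qed auto
  moreover have "{0<..} \<union> {..<1/r} = UNIV"
    using r(1) by (auto simp: not_less intro: le_less_trans[of _ 0])
  ultimately show ?thesis by simp
qed

lemma integral_dirac_sum:
  fixes f :: "'b::topological_space \<Rightarrow> real"
  assumes "finite I" "f \<in> borel_measurable borel"
  shows "(\<integral>z. f z \<partial>dirac_sum I x) = (\<Sum>i\<in>I. f (x i))"
  unfolding dirac_sum_def using assms
  by (subst integral_distr) (auto simp: lebesgue_integral_count_space_finite)

text \<open>
  The row process as a function of its points, made total on real sequences so that its continuity can be
  stated on a full product space.
\<close>

definition rows :: "nat \<Rightarrow> (nat \<Rightarrow> real) \<Rightarrow> (unit_ivl \<times> rplus) measure" where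
  "rows n x = dirac_sum {j\<in>{1..n}. 0 < x j} (\<lambda>j. (unit_of_real (real j / real n), rplus_of_real (x j)))"

lemma rows_point_measures: "rows n x \<in> point_measures"
proof -
  have "emeasure (rows n x) (UNIV \<times> ray t) < \<infinity>" if "0 < t" for t
    unfolding rows_def emeasure_dirac_sum[OF UNIV_times_ray_borel[OF that]]
    by (subst emeasure_count_space_finite) (auto simp: of_nat_less_top)
  then show ?thesis
    unfolding point_measures_def rows_def by blast
qed

text \<open>
  Dropping nonpositive coordinates does not spoil continuity: a point that moves to \<open>0\<close> leaves the
  support of every test function beforehand. Measurability of the row process follows, because preimages
  of vaguely open sets under \<open>rows n\<close> are open.
\<close>

lemma continuous_map_rows: "continuous_map euclidean vague_topology (rows n)"
  unfolding vague_topology_def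
proof (rule continuous_on_generated_topo)
  show "rows n ` topspace euclidean \<subseteq> \<Union> {{m \<in> point_measures. (\<integral>z. f z \<partial>m) \<in> U} | f U. f \<in> CK_plus \<and> open U}"
    using rows_point_measures topspace_vague
    unfolding vague_topology_def topology_generated_by_topspace by blast
  fix V assume "V \<in> {{m \<in> point_measures. (\<integral>z. f z \<partial>m) \<in> U} | f U. f \<in> CK_plus \<and> open U}"
  then obtain f U where V: "V = {m \<in> point_measures. (\<integral>z. f z \<partial>m) \<in> U}" and f: "f \<in> CK_plus" and U: "open U"
    by blast
  let ?f = "\<lambda>j y. if 0 < y then f (unit_of_real (real j / real n), rplus_of_real y) else 0"
  have "(\<integral>z. f z \<partial>rows n x) = (\<Sum>j=1..n. ?f j (x j))" for x
  proof -
    have "f \<in> borel_measurable borel"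
      using f by (intro borel_measurable_continuous_onI) (simp add: CK_plus_def)
    then show ?thesis
      unfolding rows_def by (subst integral_dirac_sum) (auto simp: sum.If_cases Int_def intro!: sum.cong)
  qed
  then have "rows n -` V \<inter> topspace euclidean = (\<lambda>x. \<Sum>j=1..n. ?f j (x j)) -` U"
    by (auto simp: V rows_point_measures)
  moreover have "continuous_on UNIV (\<lambda>x. \<Sum>j=1..n. ?f j (x j))"
    by (intro continuous_on_sum continuous_on_compose2[OF continuous_extend_CK_plus[OF f]]
        continuous_on_product_coordinates) auto
  ultimately show "openin euclidean (rows n -` V \<inter> topspace euclidean)"
    using U by (simp add: open_vimage)
qed

lemma row_process_eq_rows: "row_process X n \<omega> = rows n (\<lambda>j. X n j \<omega>)"
  by (simp add: row_process_def rows_def)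

lemma measurable_row_process:
  assumes X: "\<And>j. j \<in> {1..n} \<Longrightarrow> X n j \<in> borel_measurable M"
  shows "row_process X n \<in> M \<rightarrow>\<^sub>M borel_of vague_topology"
proof -
  \<comment> \<open>Only the coordinates of the row are known to be measurable.\<close>
  define X' where "X' \<omega> j = (if j \<in> {1..n} then X n j \<omega> else 0)" for \<omega> j
  have "X' \<in> borel_measurable M"
  proof (rule measurable_coordinatewise_then_product)
    show "(\<lambda>\<omega>. X' \<omega> j) \<in> borel_measurable M" for j
      using X[of j] unfolding X'_def by (cases "j \<in> {1..n}") (simp_all only: if_True if_False borel_measurable_const)
  qed
  moreover have "rows n \<in> borel \<rightarrow>\<^sub>M borel_of vague_topology"
    unfolding borel_of_def
  proof (rule measurable_measure_of)
    show "rows n -` U \<inter> space borel \<in> sets borel" if "U \<in> {U. openin vague_topology U}" for U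
      using openin_continuous_map_preimage[OF continuous_map_rows, of U n] that
      by (auto simp: vimage_def)
  qed (auto simp: rows_point_measures openin_subset subset_iff dest: openin_subset)
  ultimately have "(\<lambda>\<omega>. rows n (X' \<omega>)) \<in> M \<rightarrow>\<^sub>M borel_of vague_topology"
    by (rule measurable_compose)
  moreover have "rows n (X' \<omega>) = row_process X n \<omega>" for \<omega>
  proof -
    have "{j \<in> {1..n}. 0 < X' \<omega> j} = {j \<in> {1..n}. 0 < X n j \<omega>}"
      by (auto simp: X'_def)
    then show ?thesis
      unfolding rows_def row_process_def dirac_sum_def
      by (intro distr_cong) (auto simp: X'_def)
  qed
  ultimately show ?thesis
    by simp
qed

section \<open>Generating functions of the row processes and of the Poisson process\<close>

text \<open>
  Uniform smallness of the \<open>q\<close> makes the quadratic error in \<open>ln (1 - q) = - q + O(q ^ 2)\<close> negligible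
  against the sum of the \<open>q\<close>.
\<close>

lemma prod_one_minus_tendsto_exp:
  fixes q :: "nat \<Rightarrow> nat \<Rightarrow> real"
  assumes q0: "\<And>n j. j \<in> {1..n} \<Longrightarrow> 0 \<le> q n j"
    and sum: "(\<lambda>n. \<Sum>j=1..n. q n j) \<longlonglongrightarrow> L"
    and small: "\<And>e. 0 < e \<Longrightarrow> eventually (\<lambda>n. \<forall>j\<in>{1..n}. q n j \<le> e) sequentially"
  shows "(\<lambda>n. \<Prod>j=1..n. 1 - q n j) \<longlonglongrightarrow> exp (- L)"
proof -
  let ?S = "\<lambda>n. \<Sum>j=1..n. q n j"
  have S0: "0 \<le> ?S n" for n
    using q0 by (intro sum_nonneg) auto
  have bounds: "exp (- ?S n - 2 * (e * ?S n)) \<le> (\<Prod>j=1..n. 1 - q n j)"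
      "(\<Prod>j=1..n. 1 - q n j) \<le> exp (- ?S n)"
    if e: "0 < e" "e \<le> 1/2" and n: "\<forall>j\<in>{1..n}. q n j \<le> e" for e n
  proof -
    have "exp (- ?S n - 2 * (e * ?S n)) = (\<Prod>j=1..n. exp (- q n j - 2 * (e * q n j)))"
      by (simp add: exp_sum[symmetric] sum_subtractf sum_negf sum_distrib_left)
    also have "\<dots> \<le> (\<Prod>j=1..n. 1 - q n j)"
    proof (rule prod_mono, safe)
      fix j assume "j \<in> {1..n}"
      then have j: "0 \<le> q n j" "q n j \<le> e"
        using q0 n by auto
      have "- q n j - 2 * (e * q n j) \<le> - q n j - 2 * (q n j)\<^sup>2"
        using j by (simp add: power2_eq_square mult_right_mono)
      also have "\<dots> \<le> ln (1 - q n j)"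
        using j e by (intro ln_one_minus_pos_lower_bound) auto
      finally show "exp (- q n j - 2 * (e * q n j)) \<le> 1 - q n j"
        using j e by (simp add: ln_ge_iff)
    qed simp
    finally show "exp (- ?S n - 2 * (e * ?S n)) \<le> (\<Prod>j=1..n. 1 - q n j)" .
    have "(\<Prod>j=1..n. 1 - q n j) \<le> (\<Prod>j=1..n. exp (- q n j))"
      using n e exp_ge_add_one_self[of "- q n _"] by (intro prod_mono) fastforce
    then show "(\<Prod>j=1..n. 1 - q n j) \<le> exp (- ?S n)"
      by (simp add: exp_sum[symmetric] sum_negf)
  qed
  show ?thesis
  proof (rule order_tendstoI)
    fix a assume "exp (- L) < a"
    then have "eventually (\<lambda>n. exp (- ?S n) < a) sequentially"
      by (rule order_tendstoD(2)[OF tendsto_exp[OF tendsto_minus[OF sum]]])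
    moreover have "eventually (\<lambda>n. \<forall>j\<in>{1..n}. q n j \<le> 1/2) sequentially"
      by (rule small) simp
    ultimately show "eventually (\<lambda>n. (\<Prod>j=1..n. 1 - q n j) < a) sequentially"
      by eventually_elim (use bounds(2)[of "1/2"] in \<open>auto intro: le_less_trans\<close>)
  next
    fix a assume a: "a < exp (- L)"
    have "((\<lambda>e. exp (- L - 2 * (e * L))) \<longlongrightarrow> exp (- L - 2 * (0 * L))) (at_right 0)"
      by (intro tendsto_intros)
    then have "eventually (\<lambda>e. a < exp (- L - 2 * (e * L))) (at_right 0)"
      using a by (intro order_tendstoD(1)) auto
    moreover have "eventually (\<lambda>e::real. e \<in> {0<..<1/2}) (at_right 0)"
      by (rule eventually_at_right_real) simp
    ultimately have "eventually (\<lambda>e. a < exp (- L - 2 * (e * L)) \<and> e \<in> {0<..<1/2}) (at_right 0)"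
      by (rule eventually_conj)
    then obtain e where e: "a < exp (- L - 2 * (e * L))" "0 < e" "e \<le> 1/2"
      using eventually_happens[of _ "at_right (0::real)"] by fastforce
    have "(\<lambda>n. exp (- ?S n - 2 * (e * ?S n))) \<longlonglongrightarrow> exp (- L - 2 * (e * L))"
      by (intro tendsto_intros sum)
    then have "eventually (\<lambda>n. a < exp (- ?S n - 2 * (e * ?S n))) sequentially"
      using e(1) by (rule order_tendstoD)
    then show "eventually (\<lambda>n. a < (\<Prod>j=1..n. 1 - q n j)) sequentially"
      using small[OF e(2)] by eventually_elim (use bounds(1)[OF e(2,3)] in \<open>auto intro: less_le_trans\<close>)
  qed
qed

lemma pgf_poisson:
  fixes Y :: "'b \<Rightarrow> nat"
  assumes "prob_space N" and Y[measurable]: "Y \<in> N \<rightarrow>\<^sub>M count_space UNIV"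
    and pois: "\<And>k. measure N {\<omega> \<in> space N. Y \<omega> = k} = exp (- a) * a ^ k / fact k"
    and s: "0 \<le> s" "s \<le> 1"
  shows "(\<integral>\<omega>. s ^ Y \<omega> \<partial>N) = exp (- ((1 - s) * a))"
proof -
  interpret prob_space N by fact
  \<comment> \<open>At each \<open>\<omega>\<close> the partial sums of \<open>?g\<close> are eventually equal to \<open>s ^ Y \<omega>\<close>, so dominated convergence gives the expectation as a series.\<close>
  let ?g = "\<lambda>k \<omega>. s ^ k * indicator {\<omega> \<in> space N. Y \<omega> = k} \<omega>"
  have sumg: "(\<Sum>k<m. ?g k \<omega>) = (if Y \<omega> < m then s ^ Y \<omega> else 0)" if "\<omega> \<in> space N" for m \<omega>
  proof -
    have "(\<Sum>k<m. ?g k \<omega>) = (\<Sum>k<m. if Y \<omega> = k then s ^ k else 0)"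
      using that by (intro sum.cong) auto
    then show ?thesis by simp
  qed
  have "(\<lambda>m. \<integral>\<omega>. (\<Sum>k<m. ?g k \<omega>) \<partial>N) \<longlonglongrightarrow> (\<integral>\<omega>. s ^ Y \<omega> \<partial>N)"
  proof (rule integral_dominated_convergence[where w="\<lambda>_. 1"])
    show "AE \<omega> in N. (\<lambda>m. \<Sum>k<m. ?g k \<omega>) \<longlonglongrightarrow> s ^ Y \<omega>"
    proof (rule AE_I2, rule tendsto_eventually)
      fix \<omega> assume \<omega>: "\<omega> \<in> space N"
      show "eventually (\<lambda>m. (\<Sum>k<m. ?g k \<omega>) = s ^ Y \<omega>) sequentially"
        using eventually_gt_at_top[of "Y \<omega>"] by (rule eventually_mono) (simp add: sumg[OF \<omega>])
    qed
    show "AE \<omega> in N. norm (\<Sum>k<m. ?g k \<omega>) \<le> 1" for m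
      using s by (intro AE_I2) (auto simp: sumg power_le_one simp del: sum_mult_indicator)
  qed auto
  moreover have "(\<integral>\<omega>. (\<Sum>k<m. ?g k \<omega>) \<partial>N) = (\<Sum>k<m. s ^ k * (exp (- a) * a ^ k / fact k))" for m
    by (subst Bochner_Integration.integral_sum) (auto simp: pois intro!: integrable_real_indicator emeasure_finite simp: less_top[symmetric])
  ultimately have "(\<lambda>k. s ^ k * (exp (- a) * a ^ k / fact k)) sums (\<integral>\<omega>. s ^ Y \<omega> \<partial>N)"
    by (simp add: sums_def)
  moreover have "(\<lambda>k. s ^ k * (exp (- a) * a ^ k / fact k)) sums (exp (- a) * exp (s * a))"
    using sums_mult[OF exp_converges[of "s * a"], of "exp (- a)"]
    by (simp add: power_mult_distrib field_simps)
  ultimately have "(\<integral>\<omega>. s ^ Y \<omega> \<partial>N) = exp (- a) * exp (s * a)"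
    by (rule sums_unique2)
  then show ?thesis
    by (simp add: exp_add[symmetric] algebra_simps)
qed

lemma poisson_process_measurable_cnt:
  assumes N: "prob_space N" and \<zeta>: "poisson_process N \<zeta> \<Lambda>" and C: "C \<in> sets borel"
  shows "(\<lambda>\<omega>. cnt (\<zeta> \<omega>) C) \<in> N \<rightarrow>\<^sub>M count_space UNIV"
proof -
  interpret prob_space N by fact
  have "disjoint_family_on B I \<Longrightarrow> finite I \<Longrightarrow> (\<And>i. B i \<in> sets borel) \<Longrightarrow>
      indep_vars (\<lambda>_. borel) (\<lambda>i \<omega>. emeasure (\<zeta> \<omega>) (B i)) I" for I :: "nat set" and B
    using \<zeta> by (simp add: poisson_process_def)
  from this[of "\<lambda>_. C" "{0}"] C have "indep_vars (\<lambda>_. borel) (\<lambda>i \<omega>. emeasure (\<zeta> \<omega>) C) {0::nat}"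
    by (simp add: disjoint_family_on_def)
  then have [measurable]: "(\<lambda>\<omega>. emeasure (\<zeta> \<omega>) C) \<in> borel_measurable N"
    by (simp add: indep_vars_def2)
  show ?thesis
    unfolding cnt_def measure_def by measurable
qed

text \<open>
  Independence on disjoint sets is postulated for families indexed by natural numbers, so pairs are
  encoded as numbers.
\<close>

lemma pgf_poisson_process:
  fixes C :: "nat \<times> nat \<Rightarrow> (unit_ivl \<times> rplus) set" and s :: "nat \<times> nat \<Rightarrow> real"
  assumes N: "prob_space N" and \<zeta>: "poisson_process N \<zeta> \<Lambda>"
    and K: "finite K" "disjoint_family_on C K"
    and C: "\<And>k. C k \<in> sets borel" "\<And>k. k \<in> K \<Longrightarrow> C k \<subseteq> {z. recip (snd z) < u}"
      "\<And>k. k \<in> K \<Longrightarrow> emeasure \<Lambda> (C k) < \<infinity>"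
    and s: "\<And>k. k \<in> K \<Longrightarrow> 0 \<le> s k \<and> s k \<le> 1"
  shows "(\<integral>\<omega>. (\<Prod>k\<in>K. s k ^ cnt (\<zeta> \<omega>) (C k)) \<partial>N) = exp (- (\<Sum>k\<in>K. (1 - s k) * measure \<Lambda> (C k)))"
proof -
  interpret prob_space N by fact
  note cm[measurable] = poisson_process_measurable_cnt[OF N \<zeta> C(1)]
  have \<zeta>pm: "\<zeta> \<omega> \<in> point_measures" if "\<omega> \<in> space N" for \<omega>
    using \<zeta> measurable_space[of \<zeta> N "borel_of vague_topology" \<omega>] that by (simp add: poisson_process_def)
  let ?I = "prod_encode ` K" and ?B = "\<lambda>i. C (prod_decode i)" and ?s = "\<lambda>i. s (prod_decode i)"
  have "disjoint_family_on ?B ?I"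
    using K(2) by (auto simp: disjoint_family_on_def)
  then have "indep_vars (\<lambda>_. borel) (\<lambda>i \<omega>. emeasure (\<zeta> \<omega>) (?B i)) ?I"
    using \<zeta> C(1) K(1) by (simp add: poisson_process_def)
  then have "indep_vars (\<lambda>_. borel) (\<lambda>i \<omega>. ?s i ^ nat \<lfloor>enn2real (emeasure (\<zeta> \<omega>) (?B i))\<rfloor>) ?I"
    by (rule indep_vars_compose2) measurable
  then have ind: "indep_vars (\<lambda>_. borel) (\<lambda>i \<omega>. ?s i ^ cnt (\<zeta> \<omega>) (?B i)) ?I"
    by (simp add: cnt_def measure_def)
  have int: "integrable N (\<lambda>\<omega>. s k ^ cnt (\<zeta> \<omega>) (C k))" if "k \<in> K" for k
  proof (rule integrable_const_bound[where B=1])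
    show "AE \<omega> in N. norm (s k ^ cnt (\<zeta> \<omega>) (C k)) \<le> 1"
      using s[OF that] by (intro AE_I2) (auto simp: power_le_one)
  qed measurable
  have reidx: "(\<Prod>i\<in>?I. h (prod_decode i)) = (\<Prod>k\<in>K. h k)" for h :: "nat \<times> nat \<Rightarrow> real"
    by (subst prod.reindex) (auto intro: inj_on_subset[OF inj_prod_encode])
  have "(\<integral>\<omega>. (\<Prod>k\<in>K. s k ^ cnt (\<zeta> \<omega>) (C k)) \<partial>N) = (\<integral>\<omega>. (\<Prod>i\<in>?I. ?s i ^ cnt (\<zeta> \<omega>) (?B i)) \<partial>N)"
    using reidx[of "\<lambda>k. s k ^ cnt (\<zeta> _) (C k)"] by simp
  also have "\<dots> = (\<Prod>i\<in>?I. \<integral>\<omega>. ?s i ^ cnt (\<zeta> \<omega>) (?B i) \<partial>N)"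
    using K(1) int by (intro indep_vars_lebesgue_integral[OF _ ind]) auto
  also have "\<dots> = (\<Prod>k\<in>K. \<integral>\<omega>. s k ^ cnt (\<zeta> \<omega>) (C k) \<partial>N)"
    by (rule reidx)
  also have "\<dots> = (\<Prod>k\<in>K. exp (- ((1 - s k) * measure \<Lambda> (C k))))"
  proof (rule prod.cong[OF refl], rule pgf_poisson[OF N cm])
    fix k l assume k: "k \<in> K"
    have "{\<omega> \<in> space N. cnt (\<zeta> \<omega>) (C k) = l} = {\<omega> \<in> space N. emeasure (\<zeta> \<omega>) (C k) = of_nat l}"
      using emeasure_eq_cnt[OF \<zeta>pm C(1) C(2)[OF k]] cnt_eqI by (auto simp del: of_nat_eq_iff)
    then show "measure N {\<omega> \<in> space N. cnt (\<zeta> \<omega>) (C k) = l} = exp (- measure \<Lambda> (C k)) * measure \<Lambda> (C k) ^ l / fact l"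
      using \<zeta> C(1) C(3)[OF k] by (simp add: poisson_process_def)
  qed (use s in auto)
  also have "\<dots> = exp (- (\<Sum>k\<in>K. (1 - s k) * measure \<Lambda> (C k)))"
    using K(1) by (simp add: exp_sum[symmetric] sum_negf)
  finally show ?thesis .
qed

lemma cnt_rows:
  assumes "C \<in> sets borel"
  shows "cnt (rows n x) C = card {j\<in>{1..n}. 0 < x j \<and> (unit_of_real (real j / real n), rplus_of_real (x j)) \<in> C}"
  unfolding rows_def
  by (intro cnt_eqI, subst emeasure_dirac_sum[OF assms], subst emeasure_count_space_finite)
    (auto intro!: arg_cong[where f=card])

text \<open>
  For each \<open>j\<close> at most one \<open>Q j k\<close> holds, so each index \<open>j\<close> contributes at most one factor \<open>s k\<close>, and a product with
  at most one factor different from \<open>1\<close> is linear in the indicators.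
\<close>

lemma prod_power_card_hits:
  fixes s :: "'k \<Rightarrow> real"
  assumes K: "finite K" and J: "finite J"
    and disj: "\<And>j k k'. j \<in> J \<Longrightarrow> k \<in> K \<Longrightarrow> k' \<in> K \<Longrightarrow> Q j k \<Longrightarrow> Q j k' \<Longrightarrow> k = k'"
  shows "(\<Prod>k\<in>K. s k ^ card {j\<in>J. Q j k}) = (\<Prod>j\<in>J. 1 - (\<Sum>k\<in>K. (1 - s k) * of_bool (Q j k)))"
proof -
  have "(\<Prod>k\<in>K. s k ^ card {j\<in>J. Q j k}) = (\<Prod>k\<in>K. \<Prod>j\<in>J. if Q j k then s k else 1)"
    using J by (simp add: prod.If_cases Int_def)
  also have "\<dots> = (\<Prod>j\<in>J. \<Prod>k\<in>K. if Q j k then s k else 1)"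
    by (rule prod.swap)
  also have "\<dots> = (\<Prod>j\<in>J. 1 - (\<Sum>k\<in>K. (1 - s k) * of_bool (Q j k)))"
  proof (rule prod.cong[OF refl])
    fix j assume j: "j \<in> J"
    show "(\<Prod>k\<in>K. if Q j k then s k else 1) = 1 - (\<Sum>k\<in>K. (1 - s k) * of_bool (Q j k))"
    proof (cases "\<exists>k\<in>K. Q j k")
      case True
      then obtain k0 where k0: "k0 \<in> K" "Q j k0" by blast
      then have eq: "Q j k \<longleftrightarrow> k0 = k" if "k \<in> K" for k
        using disj[OF j] that by blast
      have "(\<Prod>k\<in>K. if Q j k then s k else 1) = (\<Prod>k\<in>K. if k0 = k then s k else 1)"
        by (intro prod.cong) (auto simp: eq)
      moreover have "(\<Sum>k\<in>K. (1 - s k) * of_bool (Q j k)) = (\<Sum>k\<in>K. if k0 = k then 1 - s k else 0)"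
        by (intro sum.cong) (auto simp: eq)
      ultimately show ?thesis
        using K k0 by (simp add: prod.delta)
    next
      case False
      then have "(\<Prod>k\<in>K. if Q j k then s k else 1) = (\<Prod>k\<in>K. 1)"
        and "(\<Sum>k\<in>K. (1 - s k) * of_bool (Q j k)) = (\<Sum>k\<in>K. 0)"
        by (auto intro!: prod.cong sum.cong)
      then show ?thesis by simp
    qed
  qed
  finally show ?thesis .
qed

lemma hit_set_borel:
  assumes "C \<in> sets (borel :: (unit_ivl \<times> rplus) measure)"
  shows "{x::real. 0 < x \<and> (u, rplus_of_real x) \<in> C} \<in> sets borel"
proof -
  have "Pair u -` C \<inter> space borel \<in> sets (borel :: rplus measure)"
    by (rule measurable_sets[OF borel_measurable_continuous_onI assms]) (intro continuous_intros)
  then have "rplus_of_real -` (Pair u -` C) \<inter> space (restrict_space borel {0<..}) \<in> sets (restrict_space borel {0<..})"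
    by (intro measurable_sets[OF measurable_rplus_of_real]) simp
  then have "rplus_of_real -` (Pair u -` C) \<inter> {0<..} \<in> sets borel"
    by (subst (asm) sets_restrict_space_iff) (auto simp: space_restrict_space)
  moreover have "rplus_of_real -` (Pair u -` C) \<inter> {0<..} = {x::real. 0 < x \<and> (u, rplus_of_real x) \<in> C}"
    by auto
  ultimately show ?thesis by simp
qed

lemma measurable_cnt_row_process:
  assumes X: "\<And>j. j \<in> {1..n} \<Longrightarrow> X n j \<in> borel_measurable M" and C: "C \<in> sets borel"
  shows "(\<lambda>\<omega>. cnt (row_process X n \<omega>) C) \<in> M \<rightarrow>\<^sub>M count_space UNIV"
proof -
  let ?Q = "\<lambda>j. {x. 0 < x \<and> (unit_of_real (real j / real n), rplus_of_real x) \<in> C}"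
  have "{\<omega> \<in> space M. X n j \<omega> \<in> ?Q j} \<in> sets M" if "j \<in> {1..n}" for j
    using measurable_sets[OF X[OF that] hit_set_borel[OF C]] by (simp add: vimage_def Int_def conj_commute)
  then have [measurable]: "Measurable.pred M (\<lambda>\<omega>. X n j \<omega> \<in> ?Q j)" if "j \<in> {1..n}" for j
    using that by (simp add: pred_def)
  have "cnt (row_process X n \<omega>) C = (\<Sum>j=1..n. if X n j \<omega> \<in> ?Q j then 1 else 0)" for \<omega>
    unfolding row_process_eq_rows cnt_rows[OF C] by (simp add: sum.If_cases Int_def)
  moreover have "(\<lambda>\<omega>. \<Sum>j=1..n. if X n j \<omega> \<in> ?Q j then 1 else (0::nat)) \<in> M \<rightarrow>\<^sub>M count_space UNIV"
    by measurable
  ultimately show ?thesis by simp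
qed

text \<open>
  The product over cells is rewritten as a product over the points of the row, whose expectation
  factorises by independence.
\<close>

lemma pgf_row_process:
  fixes s :: "'k \<Rightarrow> real"
  assumes M: "prob_space M" and ind: "prob_space.indep_vars M (\<lambda>_. borel) (X n) {1..n}"
    and K: "finite K" "disjoint_family_on C K" and C: "\<And>k. k \<in> K \<Longrightarrow> C k \<in> sets borel"
    and s: "\<And>k. k \<in> K \<Longrightarrow> 0 \<le> s k \<and> s k \<le> 1"
  shows "(\<integral>\<omega>. (\<Prod>k\<in>K. s k ^ cnt (row_process X n \<omega>) (C k)) \<partial>M) =
    (\<Prod>j=1..n. 1 - (\<Sum>k\<in>K. (1 - s k) * measure M
       {\<omega>\<in>space M. 0 < X n j \<omega> \<and> (unit_of_real (real j / real n), rplus_of_real (X n j \<omega>)) \<in> C k}))"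
proof -
  interpret prob_space M by fact
  let ?Q = "\<lambda>j k x. 0 < x \<and> (unit_of_real (real j / real n), rplus_of_real x) \<in> C k"
  let ?h = "\<lambda>j x. 1 - (\<Sum>k\<in>K. (1 - s k) * of_bool (?Q j k x))"
  have X: "X n j \<in> borel_measurable M" if "j \<in> {1..n}" for j
    using ind that by (auto simp: indep_vars_def)
  have Q[measurable]: "Measurable.pred borel (?Q j k)" if "k \<in> K" for j k
    using hit_set_borel[OF C[OF that]] by (simp add: pred_def)
  have h[measurable]: "?h j \<in> borel_measurable borel" for j
    by measurable
  have ind': "indep_vars (\<lambda>_. borel) (\<lambda>j \<omega>. ?h j (X n j \<omega>)) {1..n}"
    by (rule indep_vars_compose2[OF ind]) (rule h)
  have Qset: "{\<omega>\<in>space M. ?Q j k (X n j \<omega>)} \<in> sets M" if "j \<in> {1..n}" "k \<in> K" for j k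
    using measurable_compose[OF X[OF that(1)] Q[OF that(2)], of j] by (simp add: pred_def)
  have intQ: "integrable M (\<lambda>\<omega>. of_bool (?Q j k (X n j \<omega>)) :: real)"
      "(\<integral>\<omega>. of_bool (?Q j k (X n j \<omega>)) \<partial>M) = measure M {\<omega>\<in>space M. ?Q j k (X n j \<omega>)}"
    if "j \<in> {1..n}" "k \<in> K" for j k
  proof -
    have eq: "of_bool (?Q j k (X n j \<omega>)) = indicat_real {\<omega>\<in>space M. ?Q j k (X n j \<omega>)} \<omega>" if "\<omega> \<in> space M" for \<omega>
      using that by (simp add: indicator_def)
    show "integrable M (\<lambda>\<omega>. of_bool (?Q j k (X n j \<omega>)) :: real)"
      using Qset[OF that] by (subst Bochner_Integration.integrable_cong[OF refl eq]) (auto simp: less_top[symmetric])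
    show "(\<integral>\<omega>. of_bool (?Q j k (X n j \<omega>)) \<partial>M) = measure M {\<omega>\<in>space M. ?Q j k (X n j \<omega>)}"
      using Qset[OF that] by (subst Bochner_Integration.integral_cong[OF refl eq]) auto
  qed
  have inth: "integrable M (\<lambda>\<omega>. ?h j (X n j \<omega>))" if "j \<in> {1..n}" for j
    by (intro Bochner_Integration.integrable_diff Bochner_Integration.integrable_sum integrable_mult_right intQ that) auto
  have "(\<Prod>k\<in>K. s k ^ cnt (row_process X n \<omega>) (C k)) = (\<Prod>j=1..n. ?h j (X n j \<omega>))" for \<omega>
  proof -
    have "(\<Prod>k\<in>K. s k ^ cnt (row_process X n \<omega>) (C k)) = (\<Prod>k\<in>K. s k ^ card {j\<in>{1..n}. ?Q j k (X n j \<omega>)})"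
      unfolding row_process_eq_rows by (intro prod.cong refl arg_cong[where f="(^) _"] cnt_rows C)
    also have "\<dots> = (\<Prod>j=1..n. ?h j (X n j \<omega>))"
      using K(2) by (intro prod_power_card_hits K) (auto simp: disjoint_family_on_def)
    finally show ?thesis .
  qed
  then have "(\<integral>\<omega>. (\<Prod>k\<in>K. s k ^ cnt (row_process X n \<omega>) (C k)) \<partial>M) = (\<Prod>j=1..n. \<integral>\<omega>. ?h j (X n j \<omega>) \<partial>M)"
    using indep_vars_lebesgue_integral[OF _ ind' inth] by simp
  also have "\<dots> = (\<Prod>j=1..n. 1 - (\<Sum>k\<in>K. (1 - s k) * measure M {\<omega>\<in>space M. ?Q j k (X n j \<omega>)}))"
  proof (rule prod.cong[OF refl])
    fix j assume j: "j \<in> {1..n}"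
    have "(\<integral>\<omega>. (\<Sum>k\<in>K. (1 - s k) * of_bool (?Q j k (X n j \<omega>))) \<partial>M)
        = (\<Sum>k\<in>K. (1 - s k) * measure M {\<omega>\<in>space M. ?Q j k (X n j \<omega>)})"
      using intQ[OF j] by (subst Bochner_Integration.integral_sum) auto
    moreover have "integrable M (\<lambda>\<omega>. \<Sum>k\<in>K. (1 - s k) * of_bool (?Q j k (X n j \<omega>)))"
      by (intro Bochner_Integration.integrable_sum integrable_mult_right intQ j)
    ultimately show "(\<integral>\<omega>. ?h j (X n j \<omega>) \<partial>M) = 1 - (\<Sum>k\<in>K. (1 - s k) * measure M {\<omega>\<in>space M. ?Q j k (X n j \<omega>)})"
      by (subst Bochner_Integration.integral_diff) (simp_all add: prob_space)
  qed
  finally show ?thesis .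
qed

section \<open>Mass of sublevel sets from integrals of continuous functions\<close>

text \<open>
  For \<open>a < b\<close>, the continuous function that equals \<open>1\<close> up to \<open>a\<close>, vanishes from \<open>b\<close> on and is linear in between.
\<close>

definition ramp :: "real \<Rightarrow> real \<Rightarrow> real \<Rightarrow> real" where
  "ramp a b y = max 0 (min 1 ((b - y) / (b - a)))"

lemma ramp_nonneg: "0 \<le> ramp a b y" and ramp_le_1: "ramp a b y \<le> 1"
  by (auto simp: ramp_def)

lemma ramp_eq_1: "a < b \<Longrightarrow> y \<le> a \<Longrightarrow> ramp a b y = 1"
  by (auto simp: ramp_def divide_simps)

lemma ramp_eq_0: "a < b \<Longrightarrow> b \<le> y \<Longrightarrow> ramp a b y = 0"
  by (auto simp: ramp_def divide_simps)

lemma continuous_on_ramp: "continuous_on A (ramp a b)"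
  unfolding ramp_def by (cases "a = b") (auto intro!: continuous_intros)

lemma ramp_integral_bounds:
  assumes r[measurable]: "r \<in> borel_measurable \<tau>" and ab: "a < b"
    and fin: "emeasure \<tau> {x \<in> space \<tau>. r x < b} < \<infinity>"
  shows "measure \<tau> {x \<in> space \<tau>. r x \<le> a} \<le> (\<integral>x. ramp a b (r x) \<partial>\<tau>)"
    and "(\<integral>x. ramp a b (r x) \<partial>\<tau>) \<le> measure \<tau> {x \<in> space \<tau>. r x < b}"
proof -
  have [measurable]: "ramp a b \<in> borel_measurable borel"
    by (intro borel_measurable_continuous_onI continuous_on_ramp)
  have fin': "emeasure \<tau> {x \<in> space \<tau>. r x \<le> a} < \<infinity>"
    using ab by (intro le_less_trans[OF emeasure_mono fin]) auto
  have i1: "integrable \<tau> (indicat_real {x \<in> space \<tau>. r x < b})"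
    and i2: "integrable \<tau> (indicat_real {x \<in> space \<tau>. r x \<le> a})"
    using fin fin' by auto
  have le: "indicat_real {x \<in> space \<tau>. r x \<le> a} x \<le> ramp a b (r x)"
      "ramp a b (r x) \<le> indicat_real {x \<in> space \<tau>. r x < b} x" if "x \<in> space \<tau>" for x
    using that ab ramp_nonneg[of a b "r x"] ramp_le_1[of a b "r x"] ramp_eq_1[of a b "r x"] ramp_eq_0[of a b "r x"]
    by (auto simp: indicator_def not_less)
  have i3: "integrable \<tau> (\<lambda>x. ramp a b (r x))"
    using le(2) ramp_nonneg by (intro Bochner_Integration.integrable_bound[OF i1]) auto
  show "measure \<tau> {x \<in> space \<tau>. r x \<le> a} \<le> (\<integral>x. ramp a b (r x) \<partial>\<tau>)"
    using integral_mono[OF i2 i3 le(1)] by simp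
  show "(\<integral>x. ramp a b (r x) \<partial>\<tau>) \<le> measure \<tau> {x \<in> space \<tau>. r x < b}"
    using integral_mono[OF i3 i1 le(2)] by simp
qed

text \<open>
  As \<open>d\<close> tends to \<open>0\<close>, the upper ramp decreases to the indicator of \<open>r \<le> b\<close> and the lower one
  increases to that of \<open>r < b\<close>. The two have the same integral, the level set \<open>r = b\<close> being null.
\<close>

lemma sublevel_ramp_approx:
  assumes r[measurable]: "r \<in> borel_measurable \<tau>"
    and fin: "emeasure \<tau> {x \<in> space \<tau>. r x < b + 1} < \<infinity>"
    and null: "emeasure \<tau> {x \<in> space \<tau>. r x = b} = 0" and e: "0 < e"
  obtains d where "0 < d" "d \<le> 1"
    "(\<integral>x. ramp b (b + d) (r x) \<partial>\<tau>) < measure \<tau> {x \<in> space \<tau>. r x < b} + e"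
    "measure \<tau> {x \<in> space \<tau>. r x < b} - e < (\<integral>x. ramp (b - d) b (r x) \<partial>\<tau>)"
proof -
  let ?S = "{x \<in> space \<tau>. r x < b}"
  let ?A = "\<lambda>i::nat. {x \<in> space \<tau>. r x < b + 1 / Suc i}" and ?B = "\<lambda>i::nat. {x \<in> space \<tau>. r x \<le> b - 1 / Suc i}"
  have dec: "1 / real (Suc j) \<le> 1 / real (Suc i)" if "i \<le> j" for i j
    using that by (simp add: frac_le)
  have small: "\<exists>i. 1 / real (Suc i) < x" if "0 < x" for x
    using that reals_Archimedean[of x] by (auto simp: inverse_eq_divide)
  have finA: "emeasure \<tau> (?A i) < \<infinity>" for i
    by (rule le_less_trans[OF emeasure_mono fin]) (auto intro: less_le_trans)
  have finS: "emeasure \<tau> ?S < \<infinity>"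
    by (rule le_less_trans[OF emeasure_mono fin]) auto
  have "(\<lambda>i. measure \<tau> (?A i)) \<longlonglongrightarrow> measure \<tau> (\<Inter>i. ?A i)"
    using finA dec by (intro Lim_measure_decseq) (auto simp: decseq_def less_top[symmetric] intro: less_le_trans)
  moreover have "(\<Inter>i. ?A i) = ?S \<union> {x \<in> space \<tau>. r x = b}"
  proof (intro equalityI subsetI)
    fix x assume x: "x \<in> (\<Inter>i. ?A i)"
    have "r x \<le> b"
    proof (rule ccontr)
      assume "\<not> r x \<le> b"
      then obtain i where "1 / real (Suc i) < r x - b"
        using small[of "r x - b"] by auto
      moreover have "r x < b + 1 / Suc i"
        using x by blast
      ultimately show False by simp
    qed
    with x show "x \<in> ?S \<union> {x \<in> space \<tau>. r x = b}"
      by auto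
  qed (auto intro: less_trans)
  moreover have "measure \<tau> (?S \<union> {x \<in> space \<tau>. r x = b}) = measure \<tau> ?S"
    using null by (intro measure_Un_null_set) auto
  ultimately have "(\<lambda>i. measure \<tau> (?A i)) \<longlonglongrightarrow> measure \<tau> ?S"
    by simp
  then have ev1: "eventually (\<lambda>i. measure \<tau> (?A i) < measure \<tau> ?S + e) sequentially"
    using e by (intro order_tendstoD(2)) auto
  have "(\<lambda>i. measure \<tau> (?B i)) \<longlonglongrightarrow> measure \<tau> (\<Union>i. ?B i)"
  proof (rule Lim_measure_incseq)
    show "incseq ?B"
    proof (rule incseq_SucI, safe)
      fix i x assume "r x \<le> b - 1 / real (Suc i)"
      then show "r x \<le> b - 1 / real (Suc (Suc i))"
        using dec[of i "Suc i"] by simp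
    qed
    have "emeasure \<tau> (\<Union>i. ?B i) \<le> emeasure \<tau> ?S"
    proof (rule emeasure_mono)
      show "(\<Union>i. ?B i) \<subseteq> ?S"
      proof safe
        fix i x assume "r x \<le> b - 1 / real (Suc i)"
        moreover have "0 < 1 / real (Suc i)" by simp
        ultimately show "r x < b" by linarith
      qed
    qed simp
    then show "emeasure \<tau> (\<Union>i. ?B i) \<noteq> \<infinity>"
      using finS by (auto simp: less_top[symmetric] top_unique)
  qed auto
  moreover have "(\<Union>i. ?B i) = ?S"
  proof (intro equalityI subsetI)
    fix x assume x: "x \<in> ?S"
    then obtain i where "1 / real (Suc i) < b - r x"
      using small[of "b - r x"] by auto
    with x have "x \<in> ?B i"
      by simp
    then show "x \<in> (\<Union>i. ?B i)" by blast
  next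
    fix x assume "x \<in> (\<Union>i. ?B i)"
    then obtain i where x: "x \<in> space \<tau>" "r x \<le> b - 1 / real (Suc i)" by blast
    have "0 < 1 / real (Suc i)" by simp
    with x(2) have "r x < b" by linarith
    with x(1) show "x \<in> ?S" by simp
  qed
  ultimately have "eventually (\<lambda>i. measure \<tau> ?S - e < measure \<tau> (?B i)) sequentially"
    using e by (intro order_tendstoD(1)) auto
  then obtain i where i: "measure \<tau> (?A i) < measure \<tau> ?S + e" "measure \<tau> ?S - e < measure \<tau> (?B i)"
    using eventually_happens[OF eventually_conj[OF ev1]] by fastforce
  have pos: "b < b + 1 / real (Suc i)" "b - 1 / real (Suc i) < b"
    by auto
  show thesis
    using ramp_integral_bounds(2)[OF r pos(1) finA] ramp_integral_bounds(1)[OF r pos(2) finS] i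
    by (intro that[of "1 / real (Suc i)"]) (auto intro: le_less_trans less_le_trans)
qed

text \<open>
  One pair of ramps, chosen for \<open>\<tau>\<close>, transfers closeness of two integrals to closeness of masses, for every
  measure \<open>\<nu>\<close> at once. This is how uniformity in \<open>j\<close> survives the passage from functions to sets.
\<close>

lemma sublevel_measure_close:
  assumes \<tau>: "(\<integral>x. ramp b (b + d) (r x) \<partial>\<tau>) < measure \<tau> {x \<in> space \<tau>. r x < b} + e"
      "measure \<tau> {x \<in> space \<tau>. r x < b} - e < (\<integral>x. ramp (b - d) b (r x) \<partial>\<tau>)" and d: "0 < d"
    and \<nu>: "finite_measure \<nu>" "r \<in> borel_measurable \<nu>" and a: "0 \<le> a"
    and close: "\<bar>a * (\<integral>x. ramp b (b + d) (r x) \<partial>\<nu>) - (\<integral>x. ramp b (b + d) (r x) \<partial>\<tau>)\<bar> < e"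
      "\<bar>a * (\<integral>x. ramp (b - d) b (r x) \<partial>\<nu>) - (\<integral>x. ramp (b - d) b (r x) \<partial>\<tau>)\<bar> < e"
  shows "\<bar>a * measure \<nu> {x \<in> space \<nu>. r x < b} - measure \<tau> {x \<in> space \<tau>. r x < b}\<bar> < 2 * e"
proof -
  interpret finite_measure \<nu> by fact
  note [measurable] = \<nu>(2)
  have fin: "emeasure \<nu> A < \<infinity>" for A
    using emeasure_finite[of A] by (simp flip: less_top)
  have "measure \<nu> {x \<in> space \<nu>. r x < b} \<le> measure \<nu> {x \<in> space \<nu>. r x \<le> b}"
    by (intro finite_measure_mono) auto
  also have "\<dots> \<le> (\<integral>x. ramp b (b + d) (r x) \<partial>\<nu>)"
    using d fin by (intro ramp_integral_bounds \<nu>) auto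
  finally have "a * measure \<nu> {x \<in> space \<nu>. r x < b} \<le> a * (\<integral>x. ramp b (b + d) (r x) \<partial>\<nu>)"
    using a by (rule mult_left_mono)
  moreover have "a * (\<integral>x. ramp (b - d) b (r x) \<partial>\<nu>) \<le> a * measure \<nu> {x \<in> space \<nu>. r x < b}"
    using d fin a by (intro mult_left_mono ramp_integral_bounds \<nu>) auto
  ultimately show ?thesis
    using \<tau> close unfolding abs_less_iff by linarith
qed

text \<open>
  By the reciprocal a ray is isometric to the interval from \<open>0\<close> to \<open>1 / t\<close>, where \<open>0\<close> stands for \<open>\<infinity>\<close>.
\<close>

lemma compact_ray:
  assumes "0 < t" shows "compact (ray t)"
proof -
  define g where "g u = (if u = 0 then Abs_rplus \<infinity> else rplus_of_real (1 / u))" for u :: real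
  have rg: "recip (g u) = u" if "0 \<le> u" for u
  proof (cases "u = 0")
    case True
    then show ?thesis by (simp add: g_def recip_def Abs_rplus_inverse)
  qed (use that in \<open>simp add: g_def recip_rplus_of_real\<close>)
  have "dist (g u) (g v) = dist u v" if "0 \<le> u" "0 \<le> v" for u v
    unfolding dist_recip[symmetric] using that by (simp add: rg)
  then have "continuous_on {0..1/t} g"
    unfolding continuous_on_iff by (metis atLeastAtMost_iff)
  then have "compact (g ` {0..1/t})"
    by (intro compact_continuous_image) auto
  also have "g ` {0..1/t} = ray t"
  proof (intro equalityI subsetI)
    fix x assume "x \<in> ray t"
    then have "recip x \<in> {0..1/t}" "x = g (recip x)"
      using assms recip_nonneg[of x] by (auto simp: ray_eq_recip rg recip_inj[symmetric])
    then show "x \<in> g ` {0..1/t}" by blast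
  qed (use assms in \<open>auto simp: ray_eq_recip rg\<close>)
  finally show ?thesis .
qed

lemma ramp_recip_CK_plus_from:
  assumes "a < b" "b \<le> u" "0 < u"
  shows "(\<lambda>x. ramp a b (recip x)) \<in> CK_plus_from (1 / u)"
proof -
  have "closed {x. recip x \<le> u}"
    by (intro closed_Collect_le continuous_on_recip continuous_on_const)
  moreover have "{x. ramp a b (recip x) \<noteq> 0} \<subseteq> {x. recip x \<le> u}"
  proof safe
    fix x assume "ramp a b (recip x) \<noteq> 0"
    then have "recip x < b"
      using ramp_eq_0[OF assms(1), of "recip x"] by (cases "recip x < b") auto
    then show "recip x \<le> u"
      using assms(2) by simp
  qed
  ultimately have sub: "closure {x. ramp a b (recip x) \<noteq> 0} \<subseteq> ray (1 / u)"
    using assms by (simp add: closure_minimal ray_eq_recip)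
  then have "compact (closure {x. ramp a b (recip x) \<noteq> 0})"
    using compact_Int_closed[OF compact_ray[of "1 / u"] closed_closure[of "{x. ramp a b (recip x) \<noteq> 0}"]] assms
    by (simp add: Int_absorb1)
  with sub show ?thesis
    using continuous_on_compose2[OF continuous_on_ramp[of UNIV] continuous_on_recip]
    by (simp add: CK_plus_from_def CK_plus_def ramp_nonneg)
qed

section \<open>Limits of the cell probabilities\<close>

lemma discrepancy_bound:
  assumes "f \<in> CK_plus_from t" "j \<in> {1..n}" "discrepancy c P \<gamma> n t < ennreal e"
  shows "\<bar>row_sum c n / c n j * (\<integral>x. f x \<partial>P n j) - (\<integral>x. f x \<partial>\<gamma>)\<bar> < e"
proof -
  let ?g = "\<lambda>f j. ennreal \<bar>row_sum c n / c n j * (\<integral>x. f x \<partial>P n j) - (\<integral>x. f x \<partial>\<gamma>)\<bar>"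
  have "?g f j \<le> (MAX j\<in>{1..n}. ?g f j)"
    using assms(2) by (intro Max_ge) auto
  also have "\<dots> \<le> discrepancy c P \<gamma> n t"
    unfolding discrepancy_def by (rule SUP_upper[OF assms(1)])
  finally have "?g f j < ennreal e"
    using assms(3) by (rule le_less_trans)
  then show ?thesis
    by (simp add: ennreal_less_iff)
qed

lemma recip_atom:
  assumes "non_atomic \<gamma>"
  shows "emeasure \<gamma> {x. recip x = b} = 0"
proof (cases "\<exists>x. recip x = b")
  case True
  then obtain x where "recip x = b" by blast
  then have "{x. recip x = b} = {x}"
    by (auto simp: recip_inj)
  then show ?thesis
    using assms by (simp add: non_atomic_def)
qed simp

lemma row_sum_pos:
  assumes "\<And>j. j \<in> {1..n} \<Longrightarrow> 0 < c n j" "j \<in> {1..n}"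
  shows "0 < row_sum c n"
  unfolding row_sum_def using assms by (intro sum_pos) auto

lemma emeasure_sublevel_recip:
  assumes "sets \<gamma> = sets borel" "\<And>t. 0 < t \<Longrightarrow> emeasure \<gamma> (ray t) < \<infinity>"
  shows "emeasure \<gamma> {x. recip x < u} < \<infinity>"
proof (cases "0 < u")
  case True
  then have "emeasure \<gamma> {x. recip x < u} \<le> emeasure \<gamma> (ray (1 / u))"
    by (intro emeasure_mono) (auto simp: ray_eq_recip assms(1))
  also have "\<dots> < \<infinity>"
    using True by (intro assms(2)) simp
  finally show ?thesis .
next
  case False
  then have "{x. recip x < u} = {}"
    using recip_nonneg by (auto simp: not_less intro: order_trans)
  then show ?thesis by simp
qed

text \<open>
  Two test functions, an upper and a lower ramp, decide about the set \<open>recip x < u\<close>; their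
  support lies in a ray that depends on \<open>u\<close> only. Null level sets come from the absence of atoms.
\<close>

lemma uniform_sublevel_convergence:
  assumes \<gamma>: "sets \<gamma> = sets borel" "\<And>t. 0 < t \<Longrightarrow> emeasure \<gamma> (ray t) < \<infinity>" "non_atomic \<gamma>"
    and P: "\<And>n j. j \<in> {1..n} \<Longrightarrow> sets (P n j) = sets borel" "\<And>n j. j \<in> {1..n} \<Longrightarrow> finite_measure (P n j)"
    and c: "\<And>n j. j \<in> {1..n} \<Longrightarrow> 0 < c n j"
    and disc: "\<And>t. 0 < t \<Longrightarrow> (\<lambda>n. discrepancy c P \<gamma> n t) \<longlonglongrightarrow> 0"
    and e: "0 < e"
  shows "eventually (\<lambda>n. \<forall>j\<in>{1..n}. \<bar>row_sum c n / c n j * measure (P n j) {x. recip x < u}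
            - measure \<gamma> {x. recip x < u}\<bar> < e) sequentially"
proof (cases "0 < u")
  case False
  then have "{x. recip x < u} = {}"
    using recip_nonneg by (auto simp: not_less intro: order_trans)
  then show ?thesis
    using e by simp
next
  case u: True
  have sp: "space \<gamma> = UNIV"
    using \<gamma>(1) by (metis sets_eq_imp_space_eq space_borel)
  have r: "recip \<in> borel_measurable \<gamma>"
    using \<gamma>(1) by (simp cong: measurable_cong_sets)
  have fin: "emeasure \<gamma> {x \<in> space \<gamma>. recip x < u + 1} < \<infinity>"
    using emeasure_sublevel_recip[OF \<gamma>(1,2), of "u + 1"] by (simp add: sp)
  obtain d where d: "0 < d" "d \<le> 1"
    "(\<integral>x. ramp u (u + d) (recip x) \<partial>\<gamma>) < measure \<gamma> {x \<in> space \<gamma>. recip x < u} + e/2"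
    "measure \<gamma> {x \<in> space \<gamma>. recip x < u} - e/2 < (\<integral>x. ramp (u - d) u (recip x) \<partial>\<gamma>)"
    using sublevel_ramp_approx[OF r fin, of "e/2"] recip_atom[OF \<gamma>(3), of u] e by (auto simp: sp)
  define t where "t = 1 / (u + 1)"
  have t: "0 < t"
    using u by (simp add: t_def)
  have f: "(\<lambda>x. ramp u (u + d) (recip x)) \<in> CK_plus_from t" "(\<lambda>x. ramp (u - d) u (recip x)) \<in> CK_plus_from t"
    unfolding t_def using u d by (auto intro!: ramp_recip_CK_plus_from)
  have "eventually (\<lambda>n. discrepancy c P \<gamma> n t < ennreal (e/2)) sequentially"
    using order_tendstoD(2)[OF disc[OF t]] e by auto
  then show ?thesis
  proof (rule eventually_mono, intro ballI)
    fix n j assume n: "discrepancy c P \<gamma> n t < ennreal (e/2)" and j: "j \<in> {1..n}"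
    have "0 \<le> row_sum c n / c n j"
      using c[OF j] row_sum_pos[of n c, OF c j] by simp
    moreover have "recip \<in> borel_measurable (P n j)"
      using P(1)[OF j] by (simp cong: measurable_cong_sets)
    moreover have "space (P n j) = UNIV"
      using P(1)[OF j] by (metis sets_eq_imp_space_eq space_borel)
    ultimately show "\<bar>row_sum c n / c n j * measure (P n j) {x. recip x < u} - measure \<gamma> {x. recip x < u}\<bar> < e"
      using sublevel_measure_close[OF d(3,4,1) P(2)[OF j] _ _ discrepancy_bound[OF f(1) j n] discrepancy_bound[OF f(2) j n]]
      by (simp add: sp)
  qed
qed

lemma floor_level_set:
  fixes r :: "'a \<Rightarrow> real"
  assumes "0 < m"
  shows "{x. \<lfloor>real m * r x + \<theta>\<rfloor> = int i} = {x. r x < (real i + 1 - \<theta>) / real m} - {x. r x < (real i - \<theta>) / real m}"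
  using assms by (auto simp: floor_eq_iff field_simps)

lemma measure_level_set:
  fixes r :: "'a::topological_space \<Rightarrow> real"
  assumes "0 < m" and sets: "sets \<tau> = sets borel" and r: "r \<in> borel_measurable borel"
    and fin: "emeasure \<tau> {x. r x < (real i + 1 - \<theta>) / real m} < \<infinity>"
  shows "measure \<tau> {x. \<lfloor>real m * r x + \<theta>\<rfloor> = int i}
    = measure \<tau> {x. r x < (real i + 1 - \<theta>) / real m} - measure \<tau> {x. r x < (real i - \<theta>) / real m}"
  unfolding floor_level_set[OF assms(1)]
proof (rule measure_Diff)
  have [measurable]: "r \<in> borel_measurable borel" by fact
  show "{x. r x < (real i + 1 - \<theta>) / real m} \<in> sets \<tau>" "{x. r x < (real i - \<theta>) / real m} \<in> sets \<tau>"
    unfolding sets by measurable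
  show "{x. r x < (real i - \<theta>) / real m} \<subseteq> {x. r x < (real i + 1 - \<theta>) / real m}"
    using assms(1) by (auto elim!: less_le_trans simp: divide_right_mono)
qed (use fin in simp)

lemma uniform_ray_cell_convergence:
  assumes \<gamma>: "sets \<gamma> = sets borel" "\<And>t. 0 < t \<Longrightarrow> emeasure \<gamma> (ray t) < \<infinity>" "non_atomic \<gamma>"
    and P: "\<And>n j. j \<in> {1..n} \<Longrightarrow> sets (P n j) = sets borel" "\<And>n j. j \<in> {1..n} \<Longrightarrow> finite_measure (P n j)"
    and c: "\<And>n j. j \<in> {1..n} \<Longrightarrow> 0 < c n j"
    and disc: "\<And>t. 0 < t \<Longrightarrow> (\<lambda>n. discrepancy c P \<gamma> n t) \<longlonglongrightarrow> 0"
    and m: "0 < m" and e: "0 < e"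
  shows "eventually (\<lambda>n. \<forall>j\<in>{1..n}. \<bar>row_sum c n / c n j * measure (P n j) (ray_cell m l)
            - measure \<gamma> (ray_cell m l)\<bar> < e) sequentially"
proof -
  let ?u = "(real l + 1) / real m" and ?v = "real l / real m"
  have conv: "eventually (\<lambda>n. \<forall>j\<in>{1..n}. \<bar>row_sum c n / c n j * measure (P n j) {x. recip x < u}
          - measure \<gamma> {x. recip x < u}\<bar> < e/2) sequentially" for u
    by (rule uniform_sublevel_convergence[OF \<gamma> P c disc]) (use e in auto)
  have diff: "measure \<tau> (ray_cell m l) = measure \<tau> {x. recip x < ?u} - measure \<tau> {x. recip x < ?v}"
    if "sets \<tau> = sets borel" "emeasure \<tau> {x. recip x < ?u} < \<infinity>" for \<tau>
    using measure_level_set[OF m that(1), of recip l 0] that(2) by (simp add: ray_cell_def)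
  show ?thesis
    using conv[of ?u] conv[of ?v]
  proof (eventually_elim, intro ballI)
    fix n j
    assume 1: "\<forall>j\<in>{1..n}. \<bar>row_sum c n / c n j * measure (P n j) {x. recip x < ?u} - measure \<gamma> {x. recip x < ?u}\<bar> < e/2"
      and 2: "\<forall>j\<in>{1..n}. \<bar>row_sum c n / c n j * measure (P n j) {x. recip x < ?v} - measure \<gamma> {x. recip x < ?v}\<bar> < e/2"
      and j: "j \<in> {1..n}"
    have "emeasure (P n j) {x. recip x < ?u} < \<infinity>"
      using finite_measure.emeasure_finite[OF P(2)[OF j]] by (simp flip: less_top)
    then have "row_sum c n / c n j * measure (P n j) (ray_cell m l)
        = row_sum c n / c n j * measure (P n j) {x. recip x < ?u} - row_sum c n / c n j * measure (P n j) {x. recip x < ?v}"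
      by (simp only: diff[OF P(1)[OF j]] right_diff_distrib)
    moreover have "\<bar>(p - p') - (q - q')\<bar> < e" if "\<bar>p - q\<bar> < e/2" "\<bar>p' - q'\<bar> < e/2" for p p' q q' :: real
      using that by linarith
    ultimately show "\<bar>row_sum c n / c n j * measure (P n j) (ray_cell m l) - measure \<gamma> (ray_cell m l)\<bar> < e"
      using 1 2 j by (simp only: diff[OF \<gamma>(1) emeasure_sublevel_recip[OF \<gamma>(1,2)]])
  qed
qed

lemma emeasure_weight_measure:
  assumes c: "\<And>j. j \<in> {1..n} \<Longrightarrow> 0 < c n j" and A: "A \<in> sets borel"
  shows "emeasure (weight_measure c n) A = ennreal (\<Sum>j=1..n. of_bool (unit_of_real (real j / real n) \<in> A) * (c n j / row_sum c n))"
proof -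
  have c0: "0 \<le> c n j / row_sum c n" if "j \<in> {1..n}" for j
    using c[OF that] row_sum_pos[of n c, OF c that] by simp
  let ?A = "{j \<in> {1..n}. unit_of_real (real j / real n) \<in> A}"
  have "emeasure (weight_measure c n) A = emeasure (point_measure {1..n} (\<lambda>j. ennreal (c n j / row_sum c n))) ?A"
    unfolding weight_measure_def using A
    by (subst emeasure_distr) (auto simp: space_point_measure intro!: arg_cong[where f="emeasure _"])
  also have "\<dots> = (\<Sum>j\<in>?A. ennreal (c n j / row_sum c n))"
    by (rule emeasure_point_measure_finite) auto
  also have "\<dots> = ennreal (\<Sum>j\<in>?A. c n j / row_sum c n)"
    using c0 by (intro sum_ennreal) auto
  also have "(\<Sum>j\<in>?A. c n j / row_sum c n) = (\<Sum>j=1..n. of_bool (unit_of_real (real j / real n) \<in> A) * (c n j / row_sum c n))"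
    by (subst sum.inter_filter[OF finite_atLeastAtMost]) (auto intro!: sum.cong)
  finally show ?thesis .
qed

text \<open>
  The same pair of ramps as for \<open>\<gamma>\<close>, now along the coordinate of the unit interval, where the level \<open>b\<close>
  has to be a point without mass.
\<close>

lemma Rep_sublevel_convergence:
  assumes c: "\<And>n j. j \<in> {1..n} \<Longrightarrow> 0 < c n j"
    and \<mu>: "sets \<mu> = sets borel" "finite_measure \<mu>" and weak: "weak_conv_meas (weight_measure c) \<mu>"
    and null: "emeasure \<mu> {x. Rep_unit_ivl x = b} = 0"
  shows "(\<lambda>n. measure (weight_measure c n) {x. Rep_unit_ivl x < b}) \<longlonglongrightarrow> measure \<mu> {x. Rep_unit_ivl x < b}"
proof (rule LIMSEQ_I)
  fix e :: real assume e: "0 < e"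
  interpret \<mu>: finite_measure \<mu> by fact
  have sp: "space \<mu> = UNIV"
    using \<mu>(1) by (metis sets_eq_imp_space_eq space_borel)
  have r: "Rep_unit_ivl \<in> borel_measurable \<mu>"
    using \<mu>(1) by (simp cong: measurable_cong_sets)
  have fin: "emeasure \<mu> {x \<in> space \<mu>. Rep_unit_ivl x < b + 1} < \<infinity>"
    using \<mu>.emeasure_finite by (simp flip: less_top)
  obtain d where d: "0 < d" "d \<le> 1"
    "(\<integral>x. ramp b (b + d) (Rep_unit_ivl x) \<partial>\<mu>) < measure \<mu> {x \<in> space \<mu>. Rep_unit_ivl x < b} + e/2"
    "measure \<mu> {x \<in> space \<mu>. Rep_unit_ivl x < b} - e/2 < (\<integral>x. ramp (b - d) b (Rep_unit_ivl x) \<partial>\<mu>)"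
    using sublevel_ramp_approx[OF r fin, of "e/2"] null e by (auto simp: sp)
  have lim: "eventually (\<lambda>n. \<bar>1 * (\<integral>x. ramp a a' (Rep_unit_ivl x) \<partial>weight_measure c n) - (\<integral>x. ramp a a' (Rep_unit_ivl x) \<partial>\<mu>)\<bar> < e/2) sequentially" for a a'
  proof -
    have "continuous_on UNIV (\<lambda>x. ramp a a' (Rep_unit_ivl x))"
      using continuous_on_compose2[OF continuous_on_ramp[of UNIV] continuous_on_Rep_unit_ivl] by simp
    moreover have "bounded (range (\<lambda>x. ramp a a' (Rep_unit_ivl x)))"
      using ramp_nonneg ramp_le_1 by (auto simp: bounded_iff intro!: exI[of _ 1])
    ultimately have "(\<lambda>n. \<integral>x. ramp a a' (Rep_unit_ivl x) \<partial>weight_measure c n) \<longlonglongrightarrow> (\<integral>x. ramp a a' (Rep_unit_ivl x) \<partial>\<mu>)"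
      using weak by (simp add: weak_conv_meas_def)
    from tendstoD[OF this, of "e/2"] e show ?thesis
      by (simp add: dist_real_def)
  qed
  have "eventually (\<lambda>n. norm (measure (weight_measure c n) {x. Rep_unit_ivl x < b} - measure \<mu> {x. Rep_unit_ivl x < b}) < e) sequentially"
    using lim[of b "b + d"] lim[of "b - d" b]
  proof eventually_elim
    case (elim n)
    have "finite_measure (weight_measure c n)"
      using emeasure_weight_measure[of n c UNIV] c by (intro finite_measureI) (simp add: weight_measure_def)
    moreover have "Rep_unit_ivl \<in> borel_measurable (weight_measure c n)"
      by (simp add: weight_measure_def)
    ultimately show ?case
      using sublevel_measure_close[OF d(3,4,1) _ _ _ elim] by (simp add: sp weight_measure_def)
  qed
  then show "\<exists>no. \<forall>n\<ge>no. norm (measure (weight_measure c n) {x. Rep_unit_ivl x < b} - measure \<mu> {x. Rep_unit_ivl x < b}) < e"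
    by (simp add: eventually_sequentially)
qed

text \<open>
  An offset is bad if some cut point hits an atom of \<open>\<mu>\<close>. There are countably many atoms, levels and
  cut points, hence countably many bad offsets.
\<close>

lemma exists_generic_offset:
  assumes \<mu>: "finite_measure \<mu>" "sets \<mu> = sets (borel :: unit_ivl measure)"
  obtains \<theta> where "0 \<le> \<theta>" "\<theta> < 1" "\<And>m i. 0 < m \<Longrightarrow> emeasure \<mu> {x. Rep_unit_ivl x = (real i - \<theta>) / real m} = 0"
proof -
  interpret finite_measure \<mu> by fact
  define bad where "bad = (\<lambda>(x, i, m). real i - real m * Rep_unit_ivl x) ` ({x. measure \<mu> {x} \<noteq> 0} \<times> (UNIV::nat set) \<times> (UNIV::nat set))"
  have "countable bad"
    unfolding bad_def using countable_support by (intro countable_image countable_SIGMA) auto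
  moreover have "uncountable {0..<1::real}"
    by (rule uncountable_half_open_interval_1[THEN iffD2]) simp
  ultimately obtain \<theta> where \<theta>: "\<theta> \<in> {0..<1}" "\<theta> \<notin> bad"
    by (meson countable_subset subsetI)
  have "emeasure \<mu> {x. Rep_unit_ivl x = (real i - \<theta>) / real m} = 0" if "0 < m" for m i
  proof (cases "\<exists>x. Rep_unit_ivl x = (real i - \<theta>) / real m")
    case True
    then obtain x where x: "Rep_unit_ivl x = (real i - \<theta>) / real m" by blast
    then have eq: "{x. Rep_unit_ivl x = (real i - \<theta>) / real m} = {x}"
      by (auto simp: Rep_unit_ivl_inject[symmetric])
    have "\<theta> = real i - real m * Rep_unit_ivl x"
      using that by (simp add: x)
    have "measure \<mu> {x} = 0"
    proof (rule ccontr)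
      assume "measure \<mu> {x} \<noteq> 0"
      then have "\<theta> \<in> bad"
        unfolding bad_def using \<open>\<theta> = _\<close> by (intro image_eqI[of _ _ "(x, i, m)"]) auto
      with \<theta>(2) show False ..
    qed
    then show ?thesis
      unfolding eq by (simp add: emeasure_eq_measure)
  qed simp
  with \<theta>(1) that show ?thesis by auto
qed

lemma weight_unit_cell_convergence:
  assumes c: "\<And>n j. j \<in> {1..n} \<Longrightarrow> 0 < c n j"
    and \<mu>: "sets \<mu> = sets borel" "finite_measure \<mu>" and weak: "weak_conv_meas (weight_measure c) \<mu>"
    and generic: "\<And>m i. 0 < m \<Longrightarrow> emeasure \<mu> {x. Rep_unit_ivl x = (real i - \<theta>) / real m} = 0"
    and m: "0 < m"
  shows "(\<lambda>n. \<Sum>j=1..n. of_bool (unit_of_real (real j / real n) \<in> unit_cell \<theta> m i) * (c n j / row_sum c n))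
      \<longlonglongrightarrow> measure \<mu> (unit_cell \<theta> m i)"
proof -
  interpret \<mu>: finite_measure \<mu> by fact
  let ?u = "(real i + 1 - \<theta>) / real m" and ?v = "(real i - \<theta>) / real m"
  let ?w = "\<lambda>n A. \<Sum>j=1..n. of_bool (unit_of_real (real j / real n) \<in> A) * (c n j / row_sum c n)"
  have nonneg: "0 \<le> ?w n A" for n A
    using c row_sum_pos[of n c, OF c] by (intro sum_nonneg mult_nonneg_nonneg) (auto simp: less_imp_le)
  have fin: "emeasure (weight_measure c n) {x. Rep_unit_ivl x < ?u} < \<infinity>" for n
    by (subst emeasure_weight_measure[OF c]) auto
  \<comment> \<open>The right endpoint of one cell is the left endpoint of the next one, so it is generic as well.\<close>
  have "emeasure \<mu> {x. Rep_unit_ivl x = (real (Suc i) - \<theta>) / real m} = 0"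
    by (rule generic[OF m])
  then have "emeasure \<mu> {x. Rep_unit_ivl x = ?u} = 0"
    by (simp add: add.commute)
  then have "(\<lambda>n. measure (weight_measure c n) {x. Rep_unit_ivl x < ?u} - measure (weight_measure c n) {x. Rep_unit_ivl x < ?v})
      \<longlonglongrightarrow> measure \<mu> {x. Rep_unit_ivl x < ?u} - measure \<mu> {x. Rep_unit_ivl x < ?v}"
    using generic[OF m] by (intro tendsto_diff Rep_sublevel_convergence c \<mu> weak)
  moreover have "measure \<mu> {x. Rep_unit_ivl x < ?u} - measure \<mu> {x. Rep_unit_ivl x < ?v} = measure \<mu> (unit_cell \<theta> m i)"
    using \<mu>.emeasure_finite unfolding unit_cell_def
    by (intro measure_level_set[symmetric] m \<mu>) (auto simp flip: less_top)
  moreover have "measure (weight_measure c n) {x. Rep_unit_ivl x < ?u} - measure (weight_measure c n) {x. Rep_unit_ivl x < ?v}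
      = ?w n (unit_cell \<theta> m i)" for n
  proof -
    have "measure (weight_measure c n) {x. Rep_unit_ivl x < ?u} - measure (weight_measure c n) {x. Rep_unit_ivl x < ?v}
        = measure (weight_measure c n) (unit_cell \<theta> m i)"
      unfolding unit_cell_def
      by (intro measure_level_set[symmetric] m fin) (auto simp: weight_measure_def)
    then show ?thesis
      using emeasure_weight_measure[OF c unit_cell_borel] nonneg by (simp add: measure_def)
  qed
  ultimately show ?thesis by simp
qed

text \<open>
  Since \<open>p\<close> is uniformly \<open>w\<close> times \<open>g\<close> up to a small multiple of \<open>w\<close>, and the weights have total mass at most \<open>1\<close>,
  the sum of the \<open>p\<close> may be replaced by \<open>g\<close> times the sum of the weights.
\<close>

lemma weighted_sum_tendsto:
  fixes w p :: "nat \<Rightarrow> nat \<Rightarrow> real" and Q :: "nat \<Rightarrow> nat \<Rightarrow> bool"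
  assumes w: "\<And>n j. j \<in> {1..n} \<Longrightarrow> 0 < w n j" "\<And>n. (\<Sum>j=1..n. w n j) \<le> 1"
    and ratio: "\<And>e. 0 < e \<Longrightarrow> eventually (\<lambda>n. \<forall>j\<in>{1..n}. \<bar>p n j / w n j - g\<bar> < e) sequentially"
    and a: "(\<lambda>n. \<Sum>j=1..n. of_bool (Q n j) * w n j) \<longlonglongrightarrow> a"
  shows "(\<lambda>n. \<Sum>j=1..n. of_bool (Q n j) * p n j) \<longlonglongrightarrow> a * g"
proof -
  have "(\<lambda>n. (\<Sum>j=1..n. of_bool (Q n j) * p n j) - (\<Sum>j=1..n. of_bool (Q n j) * w n j) * g) \<longlonglongrightarrow> 0"
  proof (rule LIMSEQ_I)
    fix e :: real assume e: "0 < e"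
    have "eventually (\<lambda>n. norm ((\<Sum>j=1..n. of_bool (Q n j) * p n j) - (\<Sum>j=1..n. of_bool (Q n j) * w n j) * g - 0) < e) sequentially"
      using ratio[OF half_gt_zero[OF e]]
    proof eventually_elim
      case (elim n)
      have "(\<Sum>j=1..n. of_bool (Q n j) * p n j) - (\<Sum>j=1..n. of_bool (Q n j) * w n j) * g
          = (\<Sum>j=1..n. of_bool (Q n j) * (p n j - w n j * g))"
        by (simp only: right_diff_distrib sum_subtractf sum_distrib_right mult.assoc)
      also have "\<bar>\<dots>\<bar> \<le> (\<Sum>j=1..n. w n j * (e/2))"
      proof (rule order_trans[OF sum_abs], rule sum_mono)
        fix j assume j: "j \<in> {1..n}"
        have "p n j - w n j * g = w n j * (p n j / w n j - g)"
          using w(1)[OF j] by (simp add: field_simps)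
        moreover have "\<bar>w n j * (p n j / w n j - g)\<bar> \<le> w n j * (e/2)"
          using w(1)[OF j] elim j by (auto simp: abs_mult intro!: mult_left_mono less_imp_le)
        ultimately show "\<bar>of_bool (Q n j) * (p n j - w n j * g)\<bar> \<le> w n j * (e/2)"
          using w(1)[OF j] e by (auto simp: of_bool_def)
      qed
      also have "\<dots> = (\<Sum>j=1..n. w n j) * (e/2)"
        by (rule sum_distrib_right[symmetric])
      also have "\<dots> \<le> 1 * (e/2)"
        using w(2)[of n] e by (intro mult_right_mono) auto
      finally show ?case
        using e by simp
    qed
    then show "\<exists>no. \<forall>n\<ge>no. norm ((\<Sum>j=1..n. of_bool (Q n j) * p n j) - (\<Sum>j=1..n. of_bool (Q n j) * w n j) * g - 0) < e"
      by (simp add: eventually_sequentially)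
  qed
  from tendsto_add[OF this tendsto_mult[OF a tendsto_const[of g]]] show ?thesis
    by simp
qed

lemma sets_on_rplus [simp]: "sets (on_rplus Q) = sets borel"
  by (simp add: on_rplus_def)

lemma emeasure_on_rplus_distr:
  assumes X: "X \<in> borel_measurable M" and B: "B \<in> sets borel"
  shows "emeasure (on_rplus (distr M borel X)) B = emeasure M {\<omega>\<in>space M. 0 < X \<omega> \<and> rplus_of_real (X \<omega>) \<in> B}"
proof -
  have m: "rplus_of_real \<in> restrict_space (distr M borel X) {0<..} \<rightarrow>\<^sub>M borel"
    using measurable_rplus_of_real
    by (subst measurable_cong_sets[OF sets_restrict_space_cong refl]) simp_all
  have "rplus_of_real -` B \<inter> space (restrict_space borel {0<..}) \<in> sets (restrict_space borel {0<..})"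
    by (rule measurable_sets[OF measurable_rplus_of_real B])
  then have B': "rplus_of_real -` B \<inter> {0<..} \<in> sets borel"
    by (subst (asm) sets_restrict_space_iff) (auto simp: space_restrict_space)
  have "emeasure (on_rplus (distr M borel X)) B
      = emeasure (restrict_space (distr M borel X) {0<..}) (rplus_of_real -` B \<inter> {0<..})"
    unfolding on_rplus_def by (subst emeasure_distr[OF m B]) (simp add: space_restrict_space)
  also have "\<dots> = emeasure (distr M borel X) (rplus_of_real -` B \<inter> {0<..})"
    by (rule emeasure_restrict_space) auto
  also have "\<dots> = emeasure M (X -` (rplus_of_real -` B \<inter> {0<..}) \<inter> space M)"
    by (rule emeasure_distr[OF X B'])
  also have "X -` (rplus_of_real -` B \<inter> {0<..}) \<inter> space M = {\<omega>\<in>space M. 0 < X \<omega> \<and> rplus_of_real (X \<omega>) \<in> B}"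
    by auto
  finally show ?thesis .
qed

section \<open>The Poisson limit\<close>

theorem theorem2:
  fixes M :: "'a measure"
    and X :: "nat \<Rightarrow> nat \<Rightarrow> 'a \<Rightarrow> real"
    and c :: "nat \<Rightarrow> nat \<Rightarrow> real"
    and \<mu> :: "unit_ivl measure"
    and \<gamma> :: "rplus measure"
    and P :: "nat \<Rightarrow> nat \<Rightarrow> rplus measure"
    and N :: "'b measure"
    and \<zeta> :: "'b \<Rightarrow> (unit_ivl \<times> rplus) measure"
  assumes "prob_space M"
    and "\<And>n. prob_space.indep_vars M (\<lambda>_. borel) (X n) {1..n}"
    and "\<And>n j \<omega>. 1 \<le> j \<Longrightarrow> j \<le> n \<Longrightarrow> \<omega> \<in> space M \<Longrightarrow> 0 \<le> X n j \<omega>"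
    and "\<And>n j. 1 \<le> j \<Longrightarrow> j \<le> n \<Longrightarrow> non_atomic (distr M borel (X n j))"
    and P_def: "\<And>n j. P n j = on_rplus (distr M borel (X n j))"
    and "\<And>n j. 1 \<le> j \<Longrightarrow> j \<le> n \<Longrightarrow> 0 < c n j"
    and "filterlim (row_sum c) at_top sequentially"
    and "(\<lambda>n. (MAX j\<in>{1..n}. c n j) / row_sum c n) \<longlonglongrightarrow> 0"
    and "sets \<mu> = sets borel" and "finite_measure \<mu>"
    and "weak_conv_meas (weight_measure c) \<mu>"
    and "sets \<gamma> = sets borel" and "\<And>t. 0 < t \<Longrightarrow> emeasure \<gamma> (ray t) < \<infinity>"
    and "non_atomic \<gamma>"
    and "\<And>j. 1 \<le> j \<Longrightarrow> vague_conv (\<lambda>n. scale_measure (ennreal (row_sum c n / c n j)) (P n j)) \<gamma>"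
    and "\<And>t. 0 < t \<Longrightarrow> (\<lambda>n. discrepancy c P \<gamma> n t) \<longlonglongrightarrow> 0"
    and "prob_space N"
    and "poisson_process N \<zeta> (\<mu> \<Otimes>\<^sub>M \<gamma>)"
  shows "conv_in_distr vague_topology M (row_process X) N \<zeta>"
proof -
  note M = assms(1) and ind = assms(2) and max0 = assms(8) and \<mu>b = assms(9) and \<mu>fin = assms(10)
    and weak = assms(11) and \<gamma>b = assms(12) and \<gamma>fin = assms(13) and \<gamma>na = assms(14)
    and disc = assms(16) and N = assms(17) and \<zeta> = assms(18)
  interpret M: prob_space M by (rule M)
  interpret \<mu>: finite_measure \<mu> by (rule \<mu>fin)
  have c: "0 < c n j" if "j \<in> {1..n}" for n j
    using assms(6)[of j n] that by simp
  have X: "X n j \<in> borel_measurable M" if "j \<in> {1..n}" for n j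
    using ind[of n] that by (auto simp: M.indep_vars_def)
  have PM: "emeasure (P n j) B = emeasure M {\<omega>\<in>space M. 0 < X n j \<omega> \<and> rplus_of_real (X n j \<omega>) \<in> B}"
    if "j \<in> {1..n}" "B \<in> sets borel" for n j B
    unfolding P_def by (rule emeasure_on_rplus_distr[OF X[OF that(1)] that(2)])
  have Psets: "sets (P n j) = sets borel" for n j
    by (simp add: P_def)
  have Pfin: "finite_measure (P n j)" if "j \<in> {1..n}" for n j
  proof (rule finite_measureI)
    have "space (P n j) = UNIV"
      by (simp add: P_def on_rplus_def)
    then show "emeasure (P n j) (space (P n j)) \<noteq> \<infinity>"
      using PM[OF that, of UNIV] by simp
  qed
  note \<gamma>sub = emeasure_sublevel_recip[OF \<gamma>b \<gamma>fin]
  interpret \<gamma>: sigma_finite_measure \<gamma>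
  proof
    have "space \<gamma> = UNIV"
      using \<gamma>b by (metis sets_eq_imp_space_eq space_borel)
    moreover have "(\<Union>u::nat. {x. recip x < u}) = UNIV"
      using reals_Archimedean2 by auto
    ultimately show "\<exists>A. countable A \<and> A \<subseteq> sets \<gamma> \<and> \<Union> A = space \<gamma> \<and> (\<forall>a\<in>A. emeasure \<gamma> a \<noteq> \<infinity>)"
      using \<gamma>sub by (intro exI[of _ "range (\<lambda>u::nat. {x. recip x < u})"]) (auto simp: \<gamma>b less_top)
  qed
  obtain \<theta> where \<theta>: "0 \<le> \<theta>" "\<theta> < 1"
      and generic: "\<And>m i. 0 < m \<Longrightarrow> emeasure \<mu> {x. Rep_unit_ivl x = (real i - \<theta>) / real m} = 0"
    using exists_generic_offset[OF \<mu>fin \<mu>b] by blast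
  have \<Lambda>: "emeasure (\<mu> \<Otimes>\<^sub>M \<gamma>) (cell \<theta> m k) = emeasure \<mu> (unit_cell \<theta> m (fst k)) * emeasure \<gamma> (ray_cell m (snd k))" for m k
    unfolding cell_def by (rule \<gamma>.emeasure_pair_measure_Times) (simp_all add: \<mu>b \<gamma>b)
  have \<gamma>cell: "emeasure \<gamma> (ray_cell m l) < \<infinity>" if "0 < m" for m l
  proof (rule le_less_trans[OF emeasure_mono \<gamma>sub[of "(real l + 1) / real m"]])
    show "ray_cell m l \<subseteq> {x. recip x < (real l + 1) / real m}"
      using floor_level_set[OF that, of recip 0 l] by (auto simp: ray_cell_def)
  qed (simp add: \<gamma>b)
  \<comment> \<open>The weight of the point \<open>j\<close> in the row: \<open>P n j\<close> is close to \<open>w n j\<close> times \<open>\<gamma>\<close>.\<close>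
  define w where "w n j = c n j / row_sum c n" for n j
  have w: "0 < w n j" if "j \<in> {1..n}" for n j
    unfolding w_def using c that by (intro divide_pos_pos row_sum_pos) auto
  have wsum: "(\<Sum>j=1..n. w n j) \<le> 1" for n
    by (simp add: w_def row_sum_def flip: sum_divide_distrib)
  have wsmall: "eventually (\<lambda>n. \<forall>j\<in>{1..n}. w n j < e) sequentially" if "0 < e" for e
    using order_tendstoD(2)[OF max0 that]
  proof (eventually_elim, intro ballI)
    fix n j assume lt: "(MAX j\<in>{1..n}. c n j) / row_sum c n < e" and j: "j \<in> {1..n}"
    have "w n j \<le> (MAX j\<in>{1..n}. c n j) / row_sum c n"
      unfolding w_def using j row_sum_pos[of n c, OF c j] by (intro divide_right_mono Max_ge) auto
    with lt show "w n j < e" by simp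
  qed
  have ratio: "eventually (\<lambda>n. \<forall>j\<in>{1..n}. \<bar>measure (P n j) (ray_cell m l) / w n j - measure \<gamma> (ray_cell m l)\<bar> < e) sequentially"
    if "0 < m" "0 < e" for m l and e :: real
    using uniform_ray_cell_convergence[OF \<gamma>b \<gamma>fin \<gamma>na Psets Pfin c disc that, of l]
    by (simp add: w_def mult.commute)
  have wcell: "(\<lambda>n. \<Sum>j=1..n. of_bool (unit_of_real (real j / real n) \<in> unit_cell \<theta> m i) * w n j)
      \<longlonglongrightarrow> measure \<mu> (unit_cell \<theta> m i)" if "0 < m" for m i
    unfolding w_def by (rule weight_unit_cell_convergence[OF c \<mu>b \<mu>fin weak generic that])
  show ?thesis
  proof (rule conv_in_distr_of_counts[OF M N \<theta>])
    show "row_process X n \<in> M \<rightarrow>\<^sub>M borel_of vague_topology" for n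
      by (rule measurable_row_process[OF X])
    show "\<zeta> \<in> N \<rightarrow>\<^sub>M borel_of vague_topology"
      using \<zeta> by (simp add: poisson_process_def)
    show "(\<lambda>\<omega>. cnt (row_process X n \<omega>) (cell \<theta> m k)) \<in> M \<rightarrow>\<^sub>M count_space UNIV" for n m k
      by (rule measurable_cnt_row_process[OF X cell_borel])
    show "(\<lambda>\<omega>. cnt (\<zeta> \<omega>) (cell \<theta> m k)) \<in> N \<rightarrow>\<^sub>M count_space UNIV" for m k
      by (rule poisson_process_measurable_cnt[OF N \<zeta> cell_borel])
  next
    fix m and s :: "nat \<times> nat \<Rightarrow> real" assume s: "\<And>k. k \<in> grid m \<Longrightarrow> 0 < s k \<and> s k < 1"
    have mpos: "0 < m" if "k \<in> grid m" for k
      using that by (auto simp: grid_def intro!: Nat.gr0I)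
    \<comment> \<open>The factor of the point \<open>j\<close> in the generating function of the counts is \<open>1 - q n j\<close>.\<close>
    define q where "q n j = (\<Sum>k\<in>grid m. (1 - s k) * measure M
       {\<omega>\<in>space M. 0 < X n j \<omega> \<and> (unit_of_real (real j / real n), rplus_of_real (X n j \<omega>)) \<in> cell \<theta> m k})" for n j
    let ?in = "\<lambda>n j k. of_bool (unit_of_real (real j / real n) \<in> unit_cell \<theta> m (fst k)) :: real"
    have q: "q n j = (\<Sum>k\<in>grid m. (1 - s k) * (?in n j k * measure (P n j) (ray_cell m (snd k))))" if j: "j \<in> {1..n}" for n j
      unfolding q_def
    proof (rule sum.cong[OF refl])
      fix k :: "nat \<times> nat"
      have "measure (P n j) (ray_cell m (snd k)) = measure M {\<omega>\<in>space M. 0 < X n j \<omega> \<and> rplus_of_real (X n j \<omega>) \<in> ray_cell m (snd k)}"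
        using PM[OF j ray_cell_borel] by (simp add: measure_def)
      then show "(1 - s k) * measure M {\<omega>\<in>space M. 0 < X n j \<omega> \<and> (unit_of_real (real j / real n), rplus_of_real (X n j \<omega>)) \<in> cell \<theta> m k}
          = (1 - s k) * (?in n j k * measure (P n j) (ray_cell m (snd k)))"
        by (simp add: cell_def)
    qed
    have "(\<lambda>n. \<Prod>j=1..n. 1 - q n j) \<longlonglongrightarrow> exp (- (\<Sum>k\<in>grid m. (1 - s k) * measure (\<mu> \<Otimes>\<^sub>M \<gamma>) (cell \<theta> m k)))"
    proof (rule prod_one_minus_tendsto_exp)
      show "0 \<le> q n j" for n j
        unfolding q_def using s by (intro sum_nonneg mult_nonneg_nonneg) (auto simp: less_imp_le)
      have "(\<lambda>n. \<Sum>k\<in>grid m. (1 - s k) * (\<Sum>j=1..n. ?in n j k * measure (P n j) (ray_cell m (snd k))))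
          \<longlonglongrightarrow> (\<Sum>k\<in>grid m. (1 - s k) * (measure \<mu> (unit_cell \<theta> m (fst k)) * measure \<gamma> (ray_cell m (snd k))))"
        by (intro tendsto_sum tendsto_mult tendsto_const weighted_sum_tendsto[OF w wsum ratio wcell]) (auto dest: mpos)
      moreover have "(\<Sum>j=1..n. q n j) = (\<Sum>k\<in>grid m. (1 - s k) * (\<Sum>j=1..n. ?in n j k * measure (P n j) (ray_cell m (snd k))))" for n
        unfolding sum_distrib_left by (subst sum.swap) (rule sum.cong[OF refl q])
      ultimately show "(\<lambda>n. \<Sum>j=1..n. q n j) \<longlonglongrightarrow> (\<Sum>k\<in>grid m. (1 - s k) * measure (\<mu> \<Otimes>\<^sub>M \<gamma>) (cell \<theta> m k))"
        by (simp add: measure_def[of "\<mu> \<Otimes>\<^sub>M \<gamma>"] \<Lambda> measure_def enn2real_mult)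
      fix e :: real assume e: "0 < e"
      \<comment> \<open>The bound \<open>e\<close> on \<open>q n j\<close> is shared out among the cells; the summand \<open>1\<close> covers an empty grid.\<close>
      define e' where "e' = e / (real (card (grid m)) + 1)"
      have e': "0 < e'" "real (card (grid m)) * e' \<le> e"
        using e by (auto simp: e'_def field_simps)
      have "eventually (\<lambda>n. \<forall>j\<in>{1..n}. measure (P n j) (ray_cell m (snd k)) \<le> e') sequentially" if k: "k \<in> grid m" for k
      proof -
        let ?g = "measure \<gamma> (ray_cell m (snd k))"
        have g: "0 \<le> ?g" by simp
        have "0 < e' / (?g + 1)"
          using e'(1) by (intro divide_pos_pos add_nonneg_pos) auto
        from ratio[OF mpos[OF k] zero_less_one, of "snd k"] wsmall[OF this] show ?thesis
        proof (eventually_elim, intro ballI)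
          fix n j assume 1: "\<forall>j\<in>{1..n}. \<bar>measure (P n j) (ray_cell m (snd k)) / w n j - ?g\<bar> < 1"
            and 2: "\<forall>j\<in>{1..n}. w n j < e' / (?g + 1)" and j: "j \<in> {1..n}"
          have "measure (P n j) (ray_cell m (snd k)) / w n j \<le> ?g + 1"
            using 1 j by (auto simp: abs_less_iff dest!: bspec)
          then have "measure (P n j) (ray_cell m (snd k)) \<le> (?g + 1) * w n j"
            using w[OF j] by (simp add: divide_le_eq)
          also have "\<dots> \<le> (?g + 1) * (e' / (?g + 1))"
            using 2 j g by (intro mult_left_mono) (auto simp: less_imp_le)
          also have "\<dots> = e'"
            using add_nonneg_pos[OF g zero_less_one] by simp
          finally show "measure (P n j) (ray_cell m (snd k)) \<le> e'" .
        qed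
      qed
      then have "eventually (\<lambda>n. \<forall>k\<in>grid m. \<forall>j\<in>{1..n}. measure (P n j) (ray_cell m (snd k)) \<le> e') sequentially"
        by (intro eventually_ball_finite) auto
      then show "eventually (\<lambda>n. \<forall>j\<in>{1..n}. q n j \<le> e) sequentially"
      proof (eventually_elim, intro ballI)
        fix n j assume small: "\<forall>k\<in>grid m. \<forall>j\<in>{1..n}. measure (P n j) (ray_cell m (snd k)) \<le> e'" and j: "j \<in> {1..n}"
        have "q n j \<le> (\<Sum>k\<in>grid m. e')"
          unfolding q[OF j]
        proof (rule sum_mono)
          fix k assume k: "k \<in> grid m"
          have "(1 - s k) * (?in n j k * measure (P n j) (ray_cell m (snd k))) \<le> 1 * (1 * e')"
            using s[OF k] small j k e'(1) by (intro mult_mono mult_nonneg_nonneg) auto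
          then show "(1 - s k) * (?in n j k * measure (P n j) (ray_cell m (snd k))) \<le> e'"
            by simp
        qed
        with e'(2) show "q n j \<le> e" by simp
      qed
    qed
    moreover have "(\<integral>\<omega>. (\<Prod>k\<in>grid m. s k ^ cnt (row_process X n \<omega>) (cell \<theta> m k)) \<partial>M) = (\<Prod>j=1..n. 1 - q n j)" for n
      unfolding q_def using s
      by (intro pgf_row_process[OF M ind finite_grid disjoint_family_cell cell_borel]) (auto simp: less_imp_le)
    moreover have "(\<integral>\<omega>. (\<Prod>k\<in>grid m. s k ^ cnt (\<zeta> \<omega>) (cell \<theta> m k)) \<partial>N)
        = exp (- (\<Sum>k\<in>grid m. (1 - s k) * measure (\<mu> \<Otimes>\<^sub>M \<gamma>) (cell \<theta> m k)))"
    proof (rule pgf_poisson_process[OF N \<zeta> finite_grid disjoint_family_cell cell_borel cell_subset])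
      show "emeasure (\<mu> \<Otimes>\<^sub>M \<gamma>) (cell \<theta> m k) < \<infinity>" if "k \<in> grid m" for k
      proof -
        have "emeasure \<mu> (unit_cell \<theta> m (fst k)) < \<infinity>"
          using \<mu>.emeasure_finite by (simp flip: less_top)
        then show ?thesis
          unfolding \<Lambda> using \<gamma>cell[OF mpos[OF that], of "snd k"] by (simp add: ennreal_mult_less_top)
      qed
    qed (use s in \<open>auto simp: less_imp_le\<close>)
    ultimately show "(\<lambda>n. \<integral>\<omega>. (\<Prod>k\<in>grid m. s k ^ cnt (row_process X n \<omega>) (cell \<theta> m k)) \<partial>M)
        \<longlonglongrightarrow> (\<integral>\<omega>. (\<Prod>k\<in>grid m. s k ^ cnt (\<zeta> \<omega>) (cell \<theta> m k)) \<partial>N)"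
      by simp
  qed
qed

end
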